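(* Let $A\subseteq \mathbb{N}$ be a set having positive density $\varrho$ in $\mathbb{N}$, i.e. $$\lim_{n\to\infty}\frac{|\{k: k\in A,\ k\leq n\}|}{n}=\varrho>0.$$ For $k\in\mathbb{N}$ put $$p(k)=[s^k]\exp\Big(\sum_{m\in A}\frac{s^m}{m}\Big),\qquad b(k)=kp(k),\qquad B(k)=\sum_{l=1}^k b(l),$$ and assume that there are constants $\alpha>0$, $c>0$ and $0<\beta<1$ such that, as $k\to\infty$, $$B(k)=ck^{\alpha}\big(1+O(k^{-\beta})\big).$$ For $\mu>-1$ let $I_\mu=\int_0^\infty x^\mu e^{-x^2/2}\,dx$. Then, as $n\to\infty$, $$|V_{n}(A)|=c(1+\varrho)\,n^{\,n-(1-\varrho)/2}\big(I_\varrho+O(n^{-\beta/2})\big).$$ Moreover, if $\lambda_n=\lambda_n(A)$ denotes the number of cyclic elements of a random mapping uniformly distributed on $V_n(A)$, then for every fixed $z>0$, $$\mathsf{P}\Big\{\frac{\lambda_n}{\sqrt{n}}\leq z\Big\}=\frac{1}{I_\varrho}\int_0^z x^\varrho e^{-x^2/2}\,dx+O(n^{-\beta/2}).$$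
   Context: $[s^k]g(s)$ denotes the coefficient of $s^k$ in the power series expansion of a function $g$ analytic in a neighborhood of $0$. For a finite set $X$ with $n$ elements, $V_n(A)$ is the set of all mappings $f:X\to X$ such that every cycle (contour) of the functional graph of $f$ has length belonging to $A$ (these are called $A$-mappings). An element $x\in X$ is a cyclic element of $f$ if $f^j(x)=x$ for some $j\geq 1$, i.e. $x$ lies on a cycle of $f$. The paper assumes throughout that $\beta<1$. *)

theory Defs
  imports
    "HOL-Complex_Analysis.Complex_Analysis"
    "HOL-Probability.Probability"
    "HOL-Combinatorics.Orbits"
begin

subsection \<open>Coefficients\<close>

definition power_series_coeff :: "nat \<Rightarrow> (complex \<Rightarrow> complex) \<Rightarrow> complex" where
  "power_series_coeff k g = fps_nth (fps_expansion g 0) k"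

definition cycle_gf :: "nat set \<Rightarrow> complex \<Rightarrow> complex" where
  "cycle_gf A s = exp (\<Sum>\<^sub>\<infinity>m\<in>A. s ^ m / of_nat m)"

text \<open>The coefficients of \<^const>\<open>cycle_gf\<close> are real (lemma \<open>of_real_p_coeff\<close> below), so taking
  the real part loses nothing.\<close>

definition p_coeff :: "nat set \<Rightarrow> nat \<Rightarrow> real" where
  "p_coeff A k = Re (power_series_coeff k (cycle_gf A))"

definition b_coeff :: "nat set \<Rightarrow> nat \<Rightarrow> real" where
  "b_coeff A k = real k * p_coeff A k"

definition B_sum :: "nat set \<Rightarrow> nat \<Rightarrow> real" where
  "B_sum A k = (\<Sum>l = 1..k. b_coeff A l)"

subsection \<open>Mappings\<close>

text \<open>Mappings of \<open>X\<close> into itself are represented by extensional functions, so that each is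
  counted once. A cycle of the functional graph is a subset of \<open>X\<close> on which the mapping is cyclic;
  its length is its cardinality.\<close>

definition A_mappings :: "'a set \<Rightarrow> nat set \<Rightarrow> ('a \<Rightarrow> 'a) set" where
  "A_mappings X A = {f \<in> X \<rightarrow>\<^sub>E X. \<forall>C. C \<subseteq> X \<and> cyclic_on f C \<longrightarrow> card C \<in> A}"

definition cyclic_elements :: "'a set \<Rightarrow> ('a \<Rightarrow> 'a) \<Rightarrow> 'a set" where
  "cyclic_elements X f = {x \<in> X. \<exists>j\<ge>1. (f ^^ j) x = x}"

definition num_cyclic :: "'a set \<Rightarrow> ('a \<Rightarrow> 'a) \<Rightarrow> nat" where
  "num_cyclic X f = card (cyclic_elements X f)"

subsection \<open>The limit law\<close>

definition I_int :: "real \<Rightarrow> real" where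
  "I_int \<mu> = (LBINT x:{0..}. x powr \<mu> * exp (- (x\<^sup>2) / 2))"

subsection \<open>The coefficients as those of a formal exponential\<close>

lemma cycle_gf_has_fps_expansion:
  assumes "A \<subseteq> {1..}"
  shows "cycle_gf A has_fps_expansion
           fps_compose (fps_exp 1) (Abs_fps (\<lambda>m. if m \<in> A then 1 / of_nat m else 0))"
proof -
  define F :: "complex fps" where "F = Abs_fps (\<lambda>m. if m \<in> A then 1 / of_nat m else 0)"
  define G where "G = (\<lambda>s::complex. \<Sum>\<^sub>\<infinity>m\<in>A. s ^ m / of_nat m)"
  have abs: "summable (\<lambda>m. norm (fps_nth F m * s ^ m))" if "norm s < 1" for s
  proof (rule summable_comparison_test'[where N = 0])
    show "summable (\<lambda>m. norm s ^ m)"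
      using that by (simp add: summable_geometric)
    fix m :: nat
    have "norm (fps_nth F m) \<le> 1"
      by (cases "m = 0") (auto simp: F_def norm_divide divide_simps)
    then show "norm (norm (fps_nth F m * s ^ m)) \<le> norm s ^ m"
      by (simp add: norm_mult norm_power mult_left_le_one_le)
  qed
  have rad: "fps_conv_radius F > 0"
  proof -
    have "summable (\<lambda>n. fps_nth F n * (1 / 2) ^ n)"
      by (rule summable_norm_cancel) (rule abs, simp add: norm_divide)
    then have "fps_conv_radius F \<ge> norm (1 / 2 :: complex)"
      unfolding fps_conv_radius_def by (intro conv_radius_geI) auto
    moreover have "ereal (norm (1 / 2 :: complex)) > 0"
      by (simp add: norm_divide)
    ultimately show ?thesis
      by (rule less_le_trans[rotated])
  qed
  have eq: "eval_fps F s = G s" if "norm s < 1" for s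
  proof -
    have "((\<lambda>m. fps_nth F m * s ^ m) has_sum eval_fps F s) UNIV"
      unfolding eval_fps_def
      by (rule norm_summable_imp_has_sum[OF abs[OF that]])
         (rule summable_sums[OF summable_norm_cancel[OF abs[OF that]]])
    moreover have "(\<Sum>\<^sub>\<infinity>m\<in>UNIV. fps_nth F m * s ^ m) = G s"
      unfolding G_def by (rule infsum_cong_neutral) (auto simp: F_def)
    ultimately show ?thesis
      using infsumI by metis
  qed
  have "eventually (\<lambda>s. s \<in> ball (0 :: complex) 1) (nhds 0)"
    by (intro eventually_nhds_in_open) auto
  then have "eventually (\<lambda>s. eval_fps F s = G s) (nhds 0)"
    by eventually_elim (auto intro: eq)
  with rad have "G has_fps_expansion F"
    by (simp add: has_fps_expansion_def)
  moreover have "fps_nth F 0 = 0"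
    using assms by (auto simp: F_def)
  ultimately have "(exp \<circ> G) has_fps_expansion fps_compose (fps_exp 1) F"
    by (intro has_fps_expansion_compose has_fps_expansion_exp1)
  moreover have "exp \<circ> G = cycle_gf A"
    by (auto simp: G_def cycle_gf_def fun_eq_iff)
  ultimately show ?thesis
    by (simp add: F_def)
qed

lemma power_series_coeff_cycle_gf:
  assumes "A \<subseteq> {1..}"
  shows "power_series_coeff k (cycle_gf A) = of_real
           (fps_nth (fps_compose (fps_exp 1) (Abs_fps (\<lambda>m. if m \<in> A then 1 / of_nat m else 0))) k)"
proof -
  define F :: "complex fps" where "F = Abs_fps (\<lambda>m. if m \<in> A then 1 / of_nat m else 0)"
  define H :: "real fps" where "H = Abs_fps (\<lambda>m. if m \<in> A then 1 / of_nat m else 0)"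
  have pow: "fps_nth (F ^ i) n = of_real (fps_nth (H ^ i) n)" for i n
    by (induction i arbitrary: n) (auto simp: fps_mult_nth F_def H_def intro!: sum.cong)
  have "power_series_coeff k (cycle_gf A) = fps_nth (fps_compose (fps_exp 1) F) k"
    using fps_nth_fps_expansion[OF cycle_gf_has_fps_expansion[OF assms], of k]
    by (simp add: power_series_coeff_def fps_expansion_def F_def)
  then show ?thesis
    by (simp add: fps_compose_nth pow flip: H_def)
qed

lemma of_real_p_coeff:
  assumes "A \<subseteq> {1..}"
  shows "of_real (p_coeff A k) = power_series_coeff k (cycle_gf A)"
  using power_series_coeff_cycle_gf[OF assms] by (simp add: p_coeff_def)

end

theory Submission
  imports Defs "HOL-Combinatorics.Cycles" "HOL-Real_Asymp.Real_Asymp"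
begin

text \<open>A mapping is a permutation of its cyclic elements together with a forest rooted at them.
  Counting the permutations by the cycle through a fixed element and the forests by Cayley's
  formula shows that exactly \<open>n\<^bsup>n-1\<^esup> b(k) \<Prod>i<k. (1 - i/n)\<close> mappings have \<open>k\<close> cyclic elements.
  Summation by parts replaces \<open>b\<close> by \<open>B\<close> and the product is close to \<open>exp (- k\<^sup>2 / (2n))\<close>, so that the
  partial sums over \<open>k \<le> z \<surd>n\<close> are Riemann sums of step \<open>1/\<surd>n\<close> with an error that is uniform in
  \<open>z\<close>.

  The exponent is forced by the density: with \<open>P(n) = \<Sum>i\<le>n. p(i)\<close> the convolution
  \<open>B(n) = \<Sum>i\<le>n. p(i) |A \<inter> [1, n - i]|\<close> gives \<open>B(n) \<sim> \<rho>/(1+\<rho>) n P(n)\<close>, while \<open>u(n) = P(n) - B(n)/n\<close>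
  satisfies \<open>u(n+1) - u(n) = B(n) / (n(n+1))\<close>; comparing both, \<open>u(n)\<close> has growth exponent \<open>\<rho>\<close>, and
  hence \<open>\<alpha> - 1 = \<rho>\<close>.\<close>

text \<open>Only the averages \<open>B_sum\<close> are controlled, not the single coefficients, so
  the sum over \<open>b\<close> cannot be compared with an integral term by term. Summation by parts
  is exact here: from k to k + 1 the product drops by k/n times itself, which makes the new weights
  explicit. In the variable x = k / sqrt n, with h = 1 / sqrt n, the error of \<open>B_sum\<close>
  contributes h powr \<beta>, and the Gaussian approximation of the product contributes h times
  powers of x; since \<beta> < 1, the rate is h powr \<beta> = n powr (-\<beta>/2). Gaussian factors
  are traded for exp (-x), so one geometric series dominates the errors for every upper limit. Hence
  the total (limit n) and the distribution function (limit z sqrt n) come from the same estimate.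
  The exponent is identified by elementary means: a convergent sequence cannot have increments
  asymptotic to \<kappa> / n with \<kappa> nonzero, because the harmonic series diverges.\<close>

text \<open>A function on \<open>X\<close> is the pair of its restrictions to \<open>R\<close> and
  \<open>X - R\<close>; extensionality makes this a bijection. The three product formulas below
  (levels of a forest, cyclic part and forest, one cycle and the rest) are instances, so each has
  only to check \<open>iff\<close>.\<close>

lemma card_split_functions:
  assumes RX: "R \<subseteq> X"
    and FX: "F \<subseteq> extensional X" and PR: "P \<subseteq> extensional R" and QR: "Q \<subseteq> extensional (X - R)"
    and iff: "\<And>f. f \<in> extensional X \<Longrightarrow> f \<in> F \<longleftrightarrow> restrict f R \<in> P \<and> restrict f (X - R) \<in> Q"
  shows "card F = card P * card Q"
proof -
  have "bij_betw (\<lambda>f. (restrict f R, restrict f (X - R))) F (P \<times> Q)"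
  proof (rule bij_betw_byWitness[where f' = "\<lambda>(u, v) x. if x \<in> R then u x else v x"])
    show "\<forall>f\<in>F. (case (restrict f R, restrict f (X - R)) of
        (u, v) \<Rightarrow> \<lambda>x. if x \<in> R then u x else v x) = f"
      using FX by (auto simp: fun_eq_iff extensional_def restrict_def)
    have restr: "restrict (\<lambda>x. if x \<in> R then u x else v x) R = u"
      "restrict (\<lambda>x. if x \<in> R then u x else v x) (X - R) = v"
      if "u \<in> P" "v \<in> Q" for u v
      using that PR QR by (auto simp: fun_eq_iff extensional_def restrict_def)
    then show "\<forall>p\<in>P \<times> Q. (\<lambda>f. (restrict f R, restrict f (X - R)))
        (case p of (u, v) \<Rightarrow> \<lambda>x. if x \<in> R then u x else v x) = p"
      by auto
    show "(\<lambda>f. (restrict f R, restrict f (X - R))) ` F \<subseteq> P \<times> Q"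
      using iff FX by auto
    show "(\<lambda>(u, v) x. if x \<in> R then u x else v x) ` (P \<times> Q) \<subseteq> F"
    proof safe
      fix u v assume uv: "u \<in> P" "v \<in> Q"
      have "(\<lambda>x. if x \<in> R then u x else v x) \<in> extensional X"
        using uv RX PR QR by (force simp: extensional_def)
      then show "(\<lambda>x. if x \<in> R then u x else v x) \<in> F"
        using iff restr[OF uv] uv by auto
    qed
  qed
  then show ?thesis
    by (simp add: bij_betw_same_card card_cartesian_product)
qed

lemma card_eq_sum_fibers:
  assumes "finite F" "finite B" "\<phi> ` F \<subseteq> B"
  shows "card F = (\<Sum>b\<in>B. card {f \<in> F. \<phi> f = b})"
  using sum.group[OF assms, of "\<lambda>_. 1::nat"] by simp

subsection \<open>Rooted forests\<close>

text \<open>On a finite set, the absence of invariant sets outside \<open>R\<close> says that every path ends in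
  \<open>R\<close>; in this form it passes to restrictions without any iteration.\<close>

definition rooted_forests :: "'a set \<Rightarrow> 'a set \<Rightarrow> ('a \<Rightarrow> 'a) set" where
  "rooted_forests X R = {g \<in> (X - R) \<rightarrow>\<^sub>E X. \<forall>Y\<subseteq>X - R. g ` Y \<subseteq> Y \<longrightarrow> Y = {}}"

lemma finite_rooted_forests: "finite X \<Longrightarrow> finite (rooted_forests X R)"
  unfolding rooted_forests_def by (rule finite_subset[OF _ finite_PiE[of "X - R" "\<lambda>_. X"]]) auto

text \<open>\<open>S\<close> is the first level, the points sent directly into \<open>R\<close>.
  They choose their images in \<open>R\<close> freely; all deeper points map into
  \<open>X - R\<close> and form a forest there whose roots are \<open>S\<close>.\<close>

lemma card_rooted_forests_step:
  fixes X :: "'a set"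
  assumes "finite X" "R \<subseteq> X"
  shows "card (rooted_forests X R) = (\<Sum>S\<in>Pow (X - R). card R ^ card S * card (rooted_forests (X - R) S))"
proof -
  let ?F = "\<lambda>S. {g \<in> rooted_forests X R. {x \<in> X - R. g x \<in> R} = S}"
  have "card (?F S) = card R ^ card S * card (rooted_forests (X - R) S)" if S: "S \<subseteq> X - R" for S
  proof -
    have "card (?F S) = card (S \<rightarrow>\<^sub>E R) * card (rooted_forests (X - R) S)"
    proof (rule card_split_functions[OF S])
      fix g :: "'a \<Rightarrow> 'a" assume g: "g \<in> extensional (X - R)"
      show "g \<in> ?F S \<longleftrightarrow> restrict g S \<in> S \<rightarrow>\<^sub>E R \<and> restrict g (X - R - S) \<in> rooted_forests (X - R) S"
      proof
        assume F: "g \<in> ?F S"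
        have "Y = {}" if "Y \<subseteq> X - R - S" "restrict g (X - R - S) ` Y \<subseteq> Y" for Y
        proof -
          have "g ` Y \<subseteq> Y" "Y \<subseteq> X - R"
            using that by (auto simp: restrict_def subset_eq split: if_splits)
          then show ?thesis
            using F by (auto simp: rooted_forests_def)
        qed
        then show "restrict g S \<in> S \<rightarrow>\<^sub>E R \<and> restrict g (X - R - S) \<in> rooted_forests (X - R) S"
          using F by (auto simp: rooted_forests_def PiE_iff)
      next
        assume rhs: "restrict g S \<in> S \<rightarrow>\<^sub>E R \<and> restrict g (X - R - S) \<in> rooted_forests (X - R) S"
        have gS: "g x \<in> R" if "x \<in> S" for x
          using that rhs by (auto simp: PiE_iff)
        have gX: "g x \<in> X - R" if "x \<in> X - R - S" for x
          using that rhs by (auto simp: PiE_iff rooted_forests_def)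
        have "Y = {}" if Y: "Y \<subseteq> X - R" "g ` Y \<subseteq> Y" for Y
        proof -
          have "Y \<subseteq> X - R - S"
            using Y gS by auto
          moreover from this have "restrict g (X - R - S) ` Y \<subseteq> Y"
            using Y by (auto simp: restrict_def)
          ultimately show ?thesis
            using rhs by (auto simp: rooted_forests_def)
        qed
        moreover have "g \<in> (X - R) \<rightarrow>\<^sub>E X"
          using g gS gX assms by (auto simp: PiE_iff)
        moreover have "{x \<in> X - R. g x \<in> R} = S"
          using gS gX S by auto
        ultimately show "g \<in> ?F S"
          by (auto simp: rooted_forests_def)
      qed
    qed (auto simp: rooted_forests_def PiE_def)
    then show ?thesis
      using assms S finite_subset[of S "X - R"] by (simp add: card_PiE)
  qed
  moreover have "card (rooted_forests X R) = (\<Sum>S\<in>Pow (X - R). card (?F S))"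
    by (rule card_eq_sum_fibers) (use assms finite_rooted_forests in auto)
  ultimately show ?thesis
    by simp
qed

lemma sum_Pow_card:
  fixes F :: "nat \<Rightarrow> 'b::comm_semiring_1"
  assumes "finite A"
  shows "(\<Sum>S\<in>Pow A. F (card S)) = (\<Sum>j\<le>card A. of_nat (card A choose j) * F j)"
proof -
  have "(\<Sum>S\<in>Pow A. F (card S)) = (\<Sum>j\<le>card A. \<Sum>S\<in>{S\<in>Pow A. card S = j}. F (card S))"
    by (rule sum.group[symmetric]) (use assms card_mono in auto)
  also have "\<dots> = (\<Sum>j\<le>card A. of_nat (card A choose j) * F j)"
    using n_subsets[OF assms] by (intro sum.cong) auto
  finally show ?thesis .
qed

text \<open>Cayley's formula k n^(n-k-1) for n points and k given roots, multiplied out so that the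
  exponent -1 at k = n never appears. With m = n - k, first levels of size j contribute C(m,j) k^j j
  m^(m-j-1), and these add up to k (k+m)^(m-1) by the binomial theorem.\<close>

lemma card_rooted_forests:
  assumes "finite X" "R \<subseteq> X"
  shows "real (card X) * real (card (rooted_forests X R)) * real (card X) ^ card R
    = (if X = {} then 0 else real (card R) * real (card X) ^ card X)"
  using assms
proof (induction "card X" arbitrary: X R rule: less_induct)
  case less
  show ?case
  proof (cases "X = {} \<or> R = {}")
    case True
    \<comment> \<open>Without roots, \<open>X\<close> itself is a nonempty invariant set.\<close>
    moreover have "rooted_forests X {} = {}" if "X \<noteq> {}"
    proof -
      have "g ` X \<subseteq> X" if "g \<in> X \<rightarrow>\<^sub>E X" for g
        using that by auto
      then show ?thesis
        using that unfolding rooted_forests_def by auto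
    qed
    ultimately show ?thesis
      by (cases "X = {}") simp_all
  next
    case False
    then have ne: "X \<noteq> {}" "R \<noteq> {}"
      by auto
    define k where "k = card R"
    define m where "m = card (X - R)"
    have fin: "finite R" "finite (X - R)"
      using less.prems finite_subset by auto
    have k: "k > 0"
      using ne fin by (auto simp: k_def card_gt_0_iff)
    have km: "card X = k + m"
      using less.prems fin unfolding k_def m_def
      by (metis card_Diff_subset card_mono le_add_diff_inverse)
    have IH: "real m * real (card (rooted_forests (X - R) S)) * real m ^ card S
        = (if X - R = {} then 0 else real (card S) * real m ^ m)" if "S \<subseteq> X - R" for S
      using less.hyps[of "X - R" S] that fin k unfolding km by (simp add: m_def)
    show ?thesis
    proof (cases "m = 0")
      case True
      then have XR: "X = R"
        using fin less.prems by (auto simp: m_def)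
      have "rooted_forests X R = {\<lambda>_. undefined}"
        unfolding XR rooted_forests_def by auto
      then show ?thesis
        using ne XR by (simp flip: power_Suc)
    next
      case False
      then have XR: "X - R \<noteq> {}"
        unfolding m_def by (metis card.empty)
      have F: "real (card (rooted_forests (X - R) S)) = real (card S) * real m ^ m / (real m * real m ^ card S)"
        if "S \<in> Pow (X - R)" for S
        using IH[of S] XR that False by (auto simp: divide_simps mult_ac)
      have "real (card (rooted_forests X R))
          = (\<Sum>S\<in>Pow (X - R). real k ^ card S * real (card (rooted_forests (X - R) S)))"
        by (simp add: card_rooted_forests_step[OF less.prems] k_def)
      also have "\<dots> = (\<Sum>S\<in>Pow (X - R). real k ^ card S * (real (card S) * real m ^ m / (real m * real m ^ card S)))"
        using F by (intro sum.cong) auto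
      also have "\<dots> = (\<Sum>j\<le>m. real (m choose j) * (real k ^ j * (real j * real m ^ m / (real m * real m ^ j))))"
        using sum_Pow_card[OF fin(2), of "\<lambda>j. real k ^ j * (real j * real m ^ m / (real m * real m ^ j))"]
        by (simp add: m_def)
      \<comment> \<open>The summand for j = 0 vanishes. For the others, j C(m,j) = m C(m-1,j-1)
        absorbs the factor j, and shifting the index leaves a binomial sum.\<close>
      also have "\<dots> = real k * (\<Sum>j\<le>m - 1. real (m - 1 choose j) * real k ^ j * real m ^ (m - 1 - j))"
      proof -
        obtain l where l: "m = Suc l"
          using False not0_implies_Suc by blast
        have "real (Suc l choose Suc j) * (real k ^ Suc j * (real (Suc j) * real (Suc l) ^ Suc l /
            (real (Suc l) * real (Suc l) ^ Suc j)))
            = real k * (real (l choose j) * real k ^ j * real (Suc l) ^ (l - j))" if "j \<le> l" for j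
        proof -
          have c: "real (Suc l choose Suc j) * real (Suc j) = real (Suc l) * real (l choose j)"
            using Suc_times_binomial[of j l] by (metis mult.commute of_nat_mult)
          have p: "real (Suc l) ^ l = real (Suc l) ^ j * real (Suc l) ^ (l - j)"
            using that by (simp flip: power_add)
          have "real (Suc l choose Suc j) * (real k ^ Suc j * (real (Suc j) * real (Suc l) ^ Suc l /
            (real (Suc l) * real (Suc l) ^ Suc j)))
            = (real (Suc l choose Suc j) * real (Suc j)) * (real k ^ Suc j * (real (Suc l) ^ l / real (Suc l) ^ Suc j))"
            by (simp add: mult.assoc mult.left_commute del: of_nat_Suc binomial_Suc_Suc)
          also have "\<dots> = real k * (real (l choose j) * real k ^ j * real (Suc l) ^ (l - j))"
            unfolding c p by (simp add: mult.assoc mult.left_commute del: of_nat_Suc)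
          finally show ?thesis .
        qed
        then show ?thesis
          unfolding l by (subst sum.atMost_Suc_shift) (simp add: sum_distrib_left)
      qed
      also have "\<dots> = real k * (real k + real m) ^ (m - 1)"
        by (simp add: binomial_ring)
      finally have "real (card (rooted_forests X R)) = real k * real (card X) ^ (m - 1)"
        by (simp add: km)
      then have "real (card X) * real (card (rooted_forests X R)) * real (card X) ^ card R
          = real k * (real (card X) ^ Suc (m - 1 + k))"
        by (simp add: k_def[symmetric] power_add)
      also have "Suc (m - 1 + k) = card X"
        using False km by simp
      finally show ?thesis
        using ne by (simp add: k_def)
    qed
  qed
qed

subsection \<open>Permutations with cycle lengths in \<open>A\<close>\<close>

definition A_perms :: "'a set \<Rightarrow> nat set \<Rightarrow> ('a \<Rightarrow> 'a) set" where
  "A_perms X A = {f \<in> A_mappings X A. inj_on f X}"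

lemma finite_A_mappings: "finite X \<Longrightarrow> finite (A_mappings X A)"
  unfolding A_mappings_def by (rule finite_subset[OF _ finite_PiE[of X "\<lambda>_. X"]]) auto

lemma finite_A_perms: "finite X \<Longrightarrow> finite (A_perms X A)"
  unfolding A_perms_def by (simp add: finite_A_mappings)

section \<open>Periodic points of self-maps of a finite set\<close>

lemma funpow_in_set: "f ` Y \<subseteq> Y \<Longrightarrow> x \<in> Y \<Longrightarrow> (f ^^ n) x \<in> Y"
  by (induction n) auto

lemma funpow_collision:
  assumes "finite Y" "f ` Y \<subseteq> Y" "y \<in> Y"
  obtains i j where "i < j" "(f ^^ i) y = (f ^^ j) y"
proof -
  have "\<not> inj (\<lambda>i. (f ^^ i) y)"
  proof
    assume "inj (\<lambda>i. (f ^^ i) y)"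
    moreover have "range (\<lambda>i. (f ^^ i) y) \<subseteq> Y"
      using funpow_in_set[OF assms(2,3)] by auto
    ultimately show False
      using assms(1) finite_subset finite_imageD infinite_UNIV_nat by blast
  qed
  then obtain i j where "i \<noteq> j" "(f ^^ i) y = (f ^^ j) y"
    by (auto simp: inj_def)
  then show ?thesis
    using that by (cases "i < j") (auto simp: not_less_iff_gr_or_eq)
qed

text \<open>Links the invariant sets that define forests to periodic points: the iterates of any
  \<open>y\<close> in \<open>Y\<close> collide, and the earlier point of the collision is periodic,
  though \<open>y\<close> itself need not be.\<close>

lemma invariant_imp_periodic:
  assumes "finite Y" "f ` Y \<subseteq> Y" "Y \<noteq> {}"
  obtains x where "x \<in> Y" "x \<in> orbit f x"
proof -
  obtain y where y: "y \<in> Y"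
    using assms by auto
  obtain i j where ij: "i < j" "(f ^^ i) y = (f ^^ j) y"
    using funpow_collision[OF assms(1,2) y] .
  have "(f ^^ (j - i)) ((f ^^ i) y) = (f ^^ i) y"
    using ij by (metis funpow_add le_add_diff_inverse2 less_imp_le_nat o_apply)
  then have "(f ^^ i) y \<in> orbit f ((f ^^ i) y)"
    using ij unfolding orbit_altdef by (auto intro!: exI[of _ "j - i"])
  then show ?thesis
    using that funpow_in_set[OF assms(2) y] by blast
qed

text \<open>Injectivity cancels the common initial steps of a collision of iterates, so that the
  starting point itself returns. The induction on \<open>i\<close> performs one cancellation at a
  time.\<close>

lemma inj_on_imp_periodic:
  assumes "finite Y" "f ` Y \<subseteq> Y" "inj_on f Y" "y \<in> Y"
  shows "y \<in> orbit f y"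
proof -
  obtain i j where ij: "i < j" "(f ^^ i) y = (f ^^ j) y"
    using funpow_collision[OF assms(1,2,4)] .
  then have "(f ^^ (j - i)) y = y"
  proof (induction i arbitrary: j)
    case (Suc i)
    then obtain l where "j = Suc l"
      using less_imp_Suc_add by blast
    moreover have "(f ^^ i) y = (f ^^ l) y"
      using Suc.prems \<open>j = Suc l\<close> inj_onD[OF assms(3)] funpow_in_set[OF assms(2,4)] by simp
    ultimately show ?case
      using Suc by simp
  qed simp
  then show ?thesis
    using ij unfolding orbit_altdef by (auto intro!: exI[of _ "j - i"])
qed

lemma cyclic_elements_altdef: "cyclic_elements X f = {x \<in> X. x \<in> orbit f x}"
  unfolding cyclic_elements_def orbit_altdef by (force simp: Suc_le_eq)

lemma cyclic_elements_invariant: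
  assumes "f \<in> X \<rightarrow> X"
  shows "f ` cyclic_elements X f \<subseteq> cyclic_elements X f" "inj_on f (cyclic_elements X f)"
proof -
  show "f ` cyclic_elements X f \<subseteq> cyclic_elements X f"
    using assms by (auto simp: cyclic_elements_altdef orbit_sim_step)
  show "inj_on f (cyclic_elements X f)"
  proof (rule inj_onI)
    fix x y assume x: "x \<in> cyclic_elements X f" and y: "y \<in> cyclic_elements X f" and eq: "f x = f y"
    then obtain i j where i: "(f ^^ Suc i) x = x" and j: "(f ^^ Suc j) y = y"
      unfolding cyclic_elements_def by (auto simp: Suc_le_eq gr0_conv_Suc)
    \<comment> \<open>The product of two periods is a common period \<open>Suc l\<close>, so
      \<open>x\<close> and \<open>y\<close> are both recovered by applying \<open>f ^^ l\<close> to
      the common value \<open>f x = f y\<close>.\<close>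
    have "((f ^^ Suc i) ^^ Suc j) x = x"
      using i by (induction j) auto
    moreover have "((f ^^ Suc j) ^^ Suc i) y = y"
      using j by (induction i) auto
    moreover obtain l where l: "Suc i * Suc j = Suc l"
      by simp
    ultimately have "(f ^^ Suc l) x = x" "(f ^^ Suc l) y = y"
      by (metis funpow_mult mult.commute)+
    then show "x = y"
      using eq by (metis funpow_Suc_right o_apply)
  qed
qed

section \<open>Cyclic part and forest of a mapping\<close>

lemma cyclic_on_restrict: "C \<subseteq> R \<Longrightarrow> cyclic_on (restrict f R) C \<longleftrightarrow> cyclic_on f C"
  by (rule cyclic_cong) auto

text \<open>On \<open>R\<close> the mapping is a permutation, since it is injective on its periodic
  points; off \<open>R\<close> it is a forest, since an invariant set there would contain a periodic
  point. Conversely, gluing creates no cycle outside \<open>R\<close>, so the cycles are those of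
  the permutation.\<close>

lemma card_mappings_with_cyclic_set:
  fixes X :: "'a set"
  assumes "finite X" "R \<subseteq> X"
  shows "card {f \<in> A_mappings X A. cyclic_elements X f = R} = card (A_perms R A) * card (rooted_forests X R)"
proof (rule card_split_functions[OF assms(2)])
  fix f :: "'a \<Rightarrow> 'a" assume f: "f \<in> extensional X"
  show "f \<in> {f \<in> A_mappings X A. cyclic_elements X f = R} \<longleftrightarrow>
      restrict f R \<in> A_perms R A \<and> restrict f (X - R) \<in> rooted_forests X R"
  proof
    assume "f \<in> {f \<in> A_mappings X A. cyclic_elements X f = R}"
    then have F: "f \<in> X \<rightarrow>\<^sub>E X" and cyc: "\<And>C. C \<subseteq> X \<Longrightarrow> cyclic_on f C \<Longrightarrow> card C \<in> A"
      and R: "cyclic_elements X f = R"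
      by (auto simp: A_mappings_def)
    have "f ` R \<subseteq> R" "inj_on f R"
      using cyclic_elements_invariant[of f X] F R by (auto simp: PiE_iff)
    then have "restrict f R \<in> A_perms R A"
      using cyc assms cyclic_on_restrict[of _ R f] unfolding A_perms_def A_mappings_def
      by (simp add: PiE_iff image_subset_iff inj_on_restrict_eq Ball_def) (metis subset_trans)
    moreover have "Y = {}" if Y: "Y \<subseteq> X - R" "restrict f (X - R) ` Y \<subseteq> Y" for Y
    proof (rule ccontr)
      assume "Y \<noteq> {}"
      moreover have "f ` Y \<subseteq> Y"
        using Y by (force simp: restrict_def split: if_splits)
      ultimately obtain x where "x \<in> Y" "x \<in> orbit f x"
        using invariant_imp_periodic[of Y f] finite_subset[OF Y(1)] assms by auto
      then show False
        using Y R by (auto simp: cyclic_elements_altdef)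
    qed
    then have "restrict f (X - R) \<in> rooted_forests X R"
      using F by (auto simp: rooted_forests_def PiE_iff)
    ultimately show "restrict f R \<in> A_perms R A \<and> restrict f (X - R) \<in> rooted_forests X R"
      by simp
  next
    assume rhs: "restrict f R \<in> A_perms R A \<and> restrict f (X - R) \<in> rooted_forests X R"
    have fR: "f ` R \<subseteq> R" and inj: "inj_on f R"
      using rhs by (auto simp: A_perms_def A_mappings_def PiE_iff inj_on_restrict_eq)
    have fX: "f x \<in> X" if "x \<in> X - R" for x
      using rhs that by (auto simp: rooted_forests_def PiE_iff)
    have "f \<in> X \<rightarrow>\<^sub>E X"
      using f fR fX assms by (auto simp: PiE_iff)
    have *: "x \<in> R" if x: "x \<in> X" "x \<in> orbit f x" for x
    proof (rule ccontr)
      assume "x \<notin> R"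
      have oX: "orbit f x \<subseteq> X"
        using funpow_in_set[of f X x] \<open>f \<in> X \<rightarrow>\<^sub>E X\<close> x by (auto simp: orbit_altdef PiE_iff)
      \<comment> \<open>\<open>R\<close> is closed under \<open>f\<close>, and from any point of a
        periodic orbit one returns to \<open>x\<close>; meeting \<open>R\<close> would therefore put
        \<open>x\<close> into \<open>R\<close>. The orbit is then an invariant set, which the forest
        excludes.\<close>
      have "orbit f x \<inter> R = {}"
      proof (rule ccontr)
        assume "orbit f x \<inter> R \<noteq> {}"
        then obtain y where y: "y \<in> R" "y \<in> orbit f x"
          by auto
        then have "x \<in> orbit f y"
          using x orbit_swap by metis
        then show False
          using y funpow_in_set[OF fR] \<open>x \<notin> R\<close> by (auto simp: orbit_altdef)
      qed
      then have "orbit f x \<subseteq> X - R"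
        using oX by auto
      moreover from this have "restrict f (X - R) ` orbit f x \<subseteq> orbit f x"
        by (auto simp: restrict_def intro: orbit.intros)
      ultimately have "orbit f x = {}"
        using rhs by (auto simp: rooted_forests_def)
      then show False
        using x by auto
    qed
    moreover have "R \<subseteq> cyclic_elements X f"
      using inj_on_imp_periodic[OF _ fR inj] assms finite_subset by (auto simp: cyclic_elements_altdef)
    ultimately have R: "cyclic_elements X f = R"
      by (auto simp: cyclic_elements_altdef)
    have "card C \<in> A" if C: "C \<subseteq> X" "cyclic_on f C" for C
    proof -
      have "C \<subseteq> R"
        using C * by (auto simp: cyclic_on_alldef)
      then show ?thesis
        using rhs C cyclic_on_restrict[of C R f] by (auto simp: A_perms_def A_mappings_def)
    qed
    then show "f \<in> {f \<in> A_mappings X A. cyclic_elements X f = R}"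
      using R \<open>f \<in> X \<rightarrow>\<^sub>E X\<close> by (auto simp: A_mappings_def)
  qed
qed (fastforce simp: A_mappings_def A_perms_def rooted_forests_def PiE_iff)+

section \<open>Cycles as lists of points\<close>

text \<open>The equation \<open>map f ys = rotate1 ys\<close> says that \<open>f\<close> moves each
  entry to the next one and the last to the first; for distinct \<open>ys\<close> it encodes a cycle
  with a starting point. Iterating \<open>f\<close> then shifts the index modulo the length.\<close>

lemma cycle_list_nth:
  assumes "map f ys = rotate1 ys" "i < length ys"
  shows "(f ^^ k) (ys ! i) = ys ! ((i + k) mod length ys)"
proof (induction k)
  case (Suc k)
  have "f (ys ! j) = ys ! (Suc j mod length ys)" if "j < length ys" for j
    using that assms(1) nth_rotate1[OF that] nth_map[OF that, of f] by simp
  from this[of "(i + k) mod length ys"] show ?case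
    using Suc assms(2) by (cases ys) (simp_all add: mod_Suc_eq)
qed (use assms in simp)

lemma orbit_cycle_list:
  assumes "map f ys = rotate1 ys" "y \<in> set ys"
  shows "orbit f y = set ys"
proof -
  obtain i where i: "i < length ys" "y = ys ! i"
    using assms by (auto simp: in_set_conv_nth)
  have nth: "(f ^^ k) y = ys ! ((i + k) mod length ys)" for k
    using cycle_list_nth[OF assms(1) i(1)] i(2) by simp
  have "ys ! j \<in> orbit f y" if j: "j < length ys" for j
  proof -
    \<comment> \<open>The number of steps is congruent to j - i modulo the length and, as
      \<open>i < length ys\<close>, positive, which \<open>orbit\<close> demands.\<close>
    have "(f ^^ (length ys - i + j)) y = ys ! ((length ys + j) mod length ys)"
      using i(1) unfolding nth by (simp add: add.assoc[symmetric])
    then have "(f ^^ (length ys - i + j)) y = ys ! j"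
      using j by simp
    then show ?thesis
      using i unfolding orbit_altdef by (auto intro!: exI[of _ "length ys - i + j"])
  qed
  moreover have "(f ^^ k) y \<in> set ys" for k
    unfolding nth using i by (intro nth_mem mod_less_divisor) auto
  ultimately show ?thesis
    by (auto simp: orbit_altdef in_set_conv_nth)
qed

text \<open>Prescribing the head removes the freedom of rotating a cycle: both lists have the orbit
  of \<open>x\<close> as their set, hence equal length, and both enumerate the iterates of
  \<open>x\<close>.\<close>

lemma cycle_list_unique:
  assumes "distinct (x # xs)" "map f (x # xs) = rotate1 (x # xs)"
    and "distinct (x # ys)" "map f (x # ys) = rotate1 (x # ys)"
  shows "xs = ys"
proof -
  have "set (x # xs) = set (x # ys)"
    using orbit_cycle_list[OF assms(2), of x] orbit_cycle_list[OF assms(4), of x] by simp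
  then have len: "length (x # xs) = length (x # ys)"
    using assms distinct_card by metis
  have "x # xs = x # ys"
  proof (rule nth_equalityI[OF len])
    fix i assume i: "i < length (x # xs)"
    have "(f ^^ i) ((x # xs) ! 0) = (x # xs) ! i" "(f ^^ i) ((x # ys) ! 0) = (x # ys) ! i"
      using cycle_list_nth[OF assms(2), of 0 i] cycle_list_nth[OF assms(4), of 0 i] i len by simp_all
    then show "(x # xs) ! i = (x # ys) ! i"
      by simp
  qed
  then show ?thesis
    by simp
qed

lemma cycle_list_exists:
  assumes "x \<in> orbit f x"
  obtains xs where "distinct (x # xs)" "map f (x # xs) = rotate1 (x # xs)"
proof -
  \<comment> \<open>\<open>d\<close> counts the steps from \<open>f x\<close> back to
    \<open>x\<close>, so \<open>Suc d\<close> is the least period of \<open>x\<close>.\<close>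
  define d where "d = funpow_dist f (f x) x"
  define ys where "ys = map (\<lambda>i. (f ^^ i) x) [0..<Suc d]"
  have period: "(f ^^ Suc d) x = x"
    using funpow_dist1_prop[OF assms] by (simp add: d_def)
  have "distinct ys"
    using inj_on_funpow_dist1[OF assms] by (simp add: ys_def distinct_map d_def del: upt_Suc)
  moreover have "map f ys = rotate1 ys"
  proof (rule nth_equalityI)
    fix i assume "i < length (map f ys)"
    then have i: "i \<le> d"
      by (simp add: ys_def)
    have "Suc i mod Suc d = (if i = d then 0 else Suc i)"
      using i by simp
    then show "map f ys ! i = rotate1 ys ! i"
      using i period by (auto simp: ys_def nth_rotate1 simp del: upt_Suc)
  qed simp
  moreover have "ys = x # tl ys"
    by (simp add: ys_def upt_conv_Cons del: upt_Suc)
  ultimately show ?thesis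
    using that[of "tl ys"] by metis
qed

text \<open>On \<open>set ys\<close> the equation leaves a single function, and the remaining points
  carry an arbitrary permutation of the same kind. A cyclic set either avoids \<open>set ys\<close>
  or, being an orbit, equals it, so the condition on cycle lengths splits as well.\<close>

lemma card_A_perms_with_cycle:
  fixes X :: "'a set"
  assumes X: "finite X" and ys: "distinct ys" "set ys \<subseteq> X" "length ys \<in> A"
  shows "card {f \<in> A_perms X A. map f ys = rotate1 ys} = card (A_perms (X - set ys) A)"
proof -
  let ?P = "{g \<in> extensional (set ys). map g ys = rotate1 ys}"
  have "card {f \<in> A_perms X A. map f ys = rotate1 ys} = card ?P * card (A_perms (X - set ys) A)"
  proof (rule card_split_functions[OF ys(2)])
    fix f :: "'a \<Rightarrow> 'a" assume f: "f \<in> extensional X"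
    have map_eq: "map (restrict f (set ys)) ys = map f ys"
      by simp
    show "f \<in> {f \<in> A_perms X A. map f ys = rotate1 ys} \<longleftrightarrow>
        restrict f (set ys) \<in> ?P \<and> restrict f (X - set ys) \<in> A_perms (X - set ys) A"
    proof
      assume F: "f \<in> {f \<in> A_perms X A. map f ys = rotate1 ys}"
      then have inj: "inj_on f X" and fX: "f \<in> X \<rightarrow>\<^sub>E X"
        and cyc: "\<And>C. C \<subseteq> X \<Longrightarrow> cyclic_on f C \<Longrightarrow> card C \<in> A" and m: "map f ys = rotate1 ys"
        by (auto simp: A_perms_def A_mappings_def)
      have im: "f ` set ys = set ys"
        using m by (metis set_map set_rotate1)
      \<comment> \<open>All values in \<open>set ys\<close> are already taken on the cycle, so
        injectivity keeps the complement invariant.\<close>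
      have "f x \<in> X - set ys" if x: "x \<in> X - set ys" for x
      proof -
        have "f x \<notin> f ` set ys"
          using x inj ys(2) by (auto dest: inj_onD)
        then show ?thesis
          using im x fX by auto
      qed
      moreover have "inj_on f (X - set ys)"
        using inj by (rule inj_on_subset) auto
      ultimately have "restrict f (X - set ys) \<in> A_perms (X - set ys) A"
        using cyc cyclic_on_restrict[of _ "X - set ys" f]
        by (auto simp: A_perms_def A_mappings_def inj_on_restrict_eq)
      then show "restrict f (set ys) \<in> ?P \<and> restrict f (X - set ys) \<in> A_perms (X - set ys) A"
        using m map_eq by auto
    next
      assume rhs: "restrict f (set ys) \<in> ?P \<and> restrict f (X - set ys) \<in> A_perms (X - set ys) A"
      then have m: "map f ys = rotate1 ys"
        using map_eq by simp
      have im: "f ` set ys = set ys"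
        using m by (metis set_map set_rotate1)
      have "distinct (map f ys)"
        using m ys(1) by simp
      then have inj1: "inj_on f (set ys)"
        by (simp add: distinct_map)
      have inj2: "inj_on f (X - set ys)" and fX: "\<And>x. x \<in> X - set ys \<Longrightarrow> f x \<in> X - set ys"
        using rhs by (auto simp: A_perms_def A_mappings_def inj_on_restrict_eq PiE_iff)
      have "inj_on f (set ys \<union> (X - set ys))"
      proof -
        have "f x \<noteq> f y" if "x \<in> set ys" "y \<in> X - set ys" for x y
          using im fX[OF that(2)] that(1) by (metis DiffD2 imageI)
        then have "f ` (set ys - (X - set ys)) \<inter> f ` (X - set ys - set ys) = {}"
          by blast
        then show ?thesis
          unfolding inj_on_Un using inj1 inj2 by blast
      qed
      then have inj: "inj_on f X"
        using ys(2) by (simp add: Un_absorb1)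
      moreover have "f x \<in> X" if "x \<in> X" for x
      proof (cases "x \<in> set ys")
        case True
        then have "f x \<in> set ys"
          using im by blast
        then show ?thesis
          using ys(2) by auto
      qed (use fX that in auto)
      then have "f \<in> X \<rightarrow>\<^sub>E X"
        using f by (simp add: PiE_iff)
      moreover have "card C \<in> A" if C: "C \<subseteq> X" "cyclic_on f C" for C
      proof (cases "C \<inter> set ys = {}")
        case True
        then have "C \<subseteq> X - set ys"
          using C by auto
        then show ?thesis
          using rhs C cyclic_on_restrict[of C "X - set ys" f] by (auto simp: A_perms_def A_mappings_def)
      next
        case False
        then obtain y where "y \<in> C" "y \<in> set ys"
          by auto
        then have "C = set ys"
          using orbit_cycle_list[OF m] orbit_cyclic_eq3[OF C(2)] by metis
        then show ?thesis
          using ys distinct_card by metis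
      qed
      ultimately show "f \<in> {f \<in> A_perms X A. map f ys = rotate1 ys}"
        using m by (simp add: A_perms_def A_mappings_def)
    qed
  qed (auto simp: A_perms_def A_mappings_def PiE_def)
  moreover have "?P = {restrict (cycle_of_list ys) (set ys)}"
  proof -
    have rot: "map (cycle_of_list ys) ys = rotate1 ys"
      using cyclic_rotation[OF ys(1), of 1] by simp
    have "g = restrict (cycle_of_list ys) (set ys)" if "g \<in> ?P" for g
    proof (rule extensionalityI[of _ "set ys"])
      have "map g ys = map (cycle_of_list ys) ys"
        using that rot by simp
      then show "g x = restrict (cycle_of_list ys) (set ys) x" if "x \<in> set ys" for x
        using that by (simp add: map_eq_conv)
    qed (use that in auto)
    moreover have "restrict (cycle_of_list ys) (set ys) \<in> ?P"
      unfolding rot[symmetric] by simp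
    ultimately show ?thesis
      by blast
  qed
  ultimately show ?thesis
    by simp
qed

text \<open>Classifies permutations by the cycle through \<open>x\<close>. Listing it from
  \<open>x\<close> makes the list unique; \<open>L\<close> collects the possible tails, which is why
  the length condition reads \<open>Suc (length xs)\<close>.\<close>

lemma card_A_perms_step:
  fixes A :: "nat set"
  assumes X: "finite X" "x \<in> X"
  defines "L \<equiv> {xs. distinct (x # xs) \<and> set xs \<subseteq> X \<and> Suc (length xs) \<in> A}"
  shows "card (A_perms X A) = (\<Sum>xs\<in>L. card (A_perms (X - set (x # xs)) A))"
proof -
  define \<phi> where "\<phi> f = (THE xs. distinct (x # xs) \<and> map f (x # xs) = rotate1 (x # xs))" for f
  have \<phi>I: "\<phi> f = xs" if "distinct (x # xs)" "map f (x # xs) = rotate1 (x # xs)" for f xs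
    unfolding \<phi>_def
  proof (rule the_equality)
    show "distinct (x # xs) \<and> map f (x # xs) = rotate1 (x # xs)"
      using that by (rule conjI)
    show "ys = xs" if "distinct (x # ys) \<and> map f (x # ys) = rotate1 (x # ys)" for ys
      using cycle_list_unique that \<open>distinct (x # xs)\<close> \<open>map f (x # xs) = rotate1 (x # xs)\<close> by metis
  qed
  have \<phi>: "distinct (x # \<phi> f)" "map f (x # \<phi> f) = rotate1 (x # \<phi> f)" "\<phi> f \<in> L" if "f \<in> A_perms X A" for f
  proof -
    have inj: "inj_on f X" and fX: "f ` X \<subseteq> X"
      and cyc: "\<And>C. C \<subseteq> X \<Longrightarrow> cyclic_on f C \<Longrightarrow> card C \<in> A"
      using that by (auto simp: A_perms_def A_mappings_def)
    have x: "x \<in> orbit f x"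
      using inj_on_imp_periodic[OF X(1) fX inj X(2)] .
    obtain xs where xs: "distinct (x # xs)" "map f (x # xs) = rotate1 (x # xs)"
      using cycle_list_exists[OF x] .
    have orb: "orbit f x = set (x # xs)"
      using orbit_cycle_list[OF xs(2)] by simp
    have sub: "orbit f x \<subseteq> X"
      using funpow_in_set[OF fX X(2)] by (auto simp: orbit_altdef)
    have "cyclic_on f (orbit f x)"
      using x by (auto simp: cyclic_on_def)
    then have "card (set (x # xs)) \<in> A"
      using cyc[OF sub] orb by simp
    then have "Suc (length xs) \<in> A"
      using distinct_card[OF xs(1)] by simp
    then have "xs \<in> L"
      using xs orb sub by (auto simp: L_def)
    then show "distinct (x # \<phi> f)" "map f (x # \<phi> f) = rotate1 (x # \<phi> f)" "\<phi> f \<in> L"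
      using \<phi>I[OF xs] xs by auto
  qed
  have finL: "finite L"
    by (rule finite_subset[OF _ finite_subset_distinct[OF X(1)]]) (auto simp: L_def)
  have "card (A_perms X A) = (\<Sum>xs\<in>L. card {f \<in> A_perms X A. \<phi> f = xs})"
    by (rule card_eq_sum_fibers) (use X finite_A_perms finL \<phi>(3) in auto)
  also have "\<dots> = (\<Sum>xs\<in>L. card (A_perms (X - set (x # xs)) A))"
  proof (rule sum.cong)
    fix xs assume xs: "xs \<in> L"
    then have "{f \<in> A_perms X A. \<phi> f = xs} = {f \<in> A_perms X A. map f (x # xs) = rotate1 (x # xs)}"
      using \<phi> \<phi>I by (auto simp: L_def)
    then show "card {f \<in> A_perms X A. \<phi> f = xs} = card (A_perms (X - set (x # xs)) A)"
      using card_A_perms_with_cycle[OF X(1), of "x # xs" A] xs X by (simp add: L_def)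
  qed simp
  finally show ?thesis .
qed

subsection \<open>The coefficients \<open>p(k)\<close>\<close>

text \<open>With H(s) the sum of s^m / m over \<open>A\<close>, the series P = exp H satisfies P' =
  P H', and H' has coefficient 1 at j exactly when j + 1 lies in \<open>A\<close>, and 0
  otherwise.\<close>

lemma p_coeff_recurrence:
  assumes "A \<subseteq> {1..}"
  shows "p_coeff A 0 = 1"
    and "real (Suc k) * p_coeff A (Suc k) = (\<Sum>i\<le>k. if Suc (k - i) \<in> A then p_coeff A i else 0)"
proof -
  define H :: "real fps" where "H = Abs_fps (\<lambda>m. if m \<in> A then 1 / of_nat m else 0)"
  define P where "P = fps_exp 1 oo H"
  have p: "p_coeff A k = fps_nth P k" for k
    using power_series_coeff_cycle_gf[OF assms, of k] by (simp add: p_coeff_def P_def H_def)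
  have H0: "fps_nth H 0 = 0"
    using assms by (auto simp: H_def)
  show "p_coeff A 0 = 1"
    by (simp add: p P_def)
  have "fps_deriv P = P * fps_deriv H"
    unfolding P_def using fps_compose_deriv[OF H0, of "fps_exp 1"] by simp
  then have "fps_nth (fps_deriv P) k = (\<Sum>i=0..k. fps_nth P i * fps_nth (fps_deriv H) (k - i))"
    by (simp add: fps_mult_nth)
  moreover have "fps_nth (fps_deriv H) j = (if Suc j \<in> A then 1 else 0)" for j
    by (simp add: H_def)
  ultimately have "fps_nth (fps_deriv P) k = (\<Sum>i=0..k. if Suc (k - i) \<in> A then fps_nth P i else 0)"
    by (simp add: if_distrib cong: if_cong del: fps_deriv_nth)
  then show "real (Suc k) * p_coeff A (Suc k) = (\<Sum>i\<le>k. if Suc (k - i) \<in> A then p_coeff A i else 0)"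
    by (simp add: p atMost_atLeast0 cong: if_cong)
qed

lemma p_coeff_nonneg:
  assumes "A \<subseteq> {1..}"
  shows "p_coeff A k \<ge> 0"
proof (induction k rule: less_induct)
  case (less k)
  show ?case
  proof (cases k)
    case (Suc l)
    have "real (Suc l) * p_coeff A (Suc l) \<ge> 0"
      unfolding p_coeff_recurrence[OF assms] using less Suc by (intro sum_nonneg) auto
    then show ?thesis
      using Suc by (simp add: zero_le_mult_iff del: of_nat_Suc)
  qed (simp add: p_coeff_recurrence[OF assms])
qed

lemma card_distinct_lists:
  assumes "finite Y" "l \<le> card Y"
  shows "card {xs. length xs = l \<and> distinct xs \<and> set xs \<subseteq> Y} * fact (card Y - l) = (fact (card Y) :: nat)"
proof -
  have "card {xs. length xs = l \<and> distinct xs \<and> set xs \<subseteq> Y} = fact (card Y) div fact (card Y - l)"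
    using card_lists_distinct_length_eq[OF assms] fact_div_fact[of "card Y - l" "card Y"] by simp
  then show ?thesis
    by (simp add: fact_dvd)
qed

text \<open>Both sides satisfy the same recurrence. With k = |X| - 1, a cycle with l further points
  besides the fixed one can be listed in k!/(k-l)! ways, and the rest has (k-l)! p(k-l) permutations
  by induction; so l contributes k! p(k-l) when l + 1 is in \<open>A\<close>, and 0
  otherwise.\<close>

lemma card_A_perms:
  assumes "A \<subseteq> {1..}" "finite X"
  shows "real (card (A_perms X A)) = fact (card X) * p_coeff A (card X)"
  using assms(2)
proof (induction "card X" arbitrary: X rule: less_induct)
  case less
  show ?case
  proof (cases "X = {}")
    case True
    then have "A_perms X A = {\<lambda>_. undefined}"
      by (auto simp: A_perms_def A_mappings_def cyclic_on_def)
    then show ?thesis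
      using True p_coeff_recurrence(1)[OF assms(1)] by simp
  next
    case False
    then obtain x where x: "x \<in> X"
      by auto
    define L where "L = {xs. distinct (x # xs) \<and> set xs \<subseteq> X \<and> Suc (length xs) \<in> A}"
    define Y where "Y = X - {x}"
    define k where "k = card Y"
    have k: "card X = Suc k"
      unfolding k_def Y_def using card.remove[OF less.prems x] by simp
    have finY: "finite Y"
      using less.prems by (simp add: Y_def)
    have finL: "finite L"
      by (rule finite_subset[OF _ finite_subset_distinct[OF less.prems]]) (auto simp: L_def)
    define g where "g l = (fact (k - l) * p_coeff A (k - l) :: real)" for l
    have trm: "real (card (A_perms (X - set (x # xs)) A)) = g (length xs)"
      and len: "length xs \<le> k" if "xs \<in> L" for xs
    proof -
      have sub: "set (x # xs) \<subseteq> X" "distinct (x # xs)"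
        using that x by (auto simp: L_def)
      have c: "card (set (x # xs)) = Suc (length xs)"
        using distinct_card[OF sub(2)] by simp
      show "length xs \<le> k"
        using c card_mono[OF less.prems sub(1)] k by simp
      have d: "card (X - set (x # xs)) = k - length xs"
        using card_Diff_subset[OF _ sub(1)] c k by simp
      show "real (card (A_perms (X - set (x # xs)) A)) = g (length xs)"
        using less.hyps[of "X - set (x # xs)"] less.prems d k by (simp add: g_def)
    qed
    have "real (card (A_perms X A)) = (\<Sum>xs\<in>L. g (length xs))"
      using card_A_perms_step[OF less.prems x, of A] trm by (simp add: L_def)
    also have "\<dots> = (\<Sum>l\<le>k. \<Sum>xs\<in>{xs\<in>L. length xs = l}. g (length xs))"
      by (rule sum.group[symmetric]) (use finL len in auto)
    also have "\<dots> = (\<Sum>l\<le>k. fact k * (if Suc l \<in> A then p_coeff A (k - l) else 0))"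
    proof (rule sum.cong)
      fix l assume "l \<in> {..k}"
      then have l: "l \<le> card Y"
        by (simp add: k_def)
      have eq: "{xs\<in>L. length xs = l} = (if Suc l \<in> A then {xs. length xs = l \<and> distinct xs \<and> set xs \<subseteq> Y} else {})"
        by (auto simp: L_def Y_def)
      have "real (card {xs\<in>L. length xs = l}) * fact (k - l) = (if Suc l \<in> A then fact k else 0)"
      proof (cases "Suc l \<in> A")
        case True
        then have "card {xs\<in>L. length xs = l} * fact (k - l) = (fact k :: nat)"
          using eq card_distinct_lists[OF finY l] unfolding k_def by simp
        then have "real (card {xs\<in>L. length xs = l} * fact (k - l)) = real (fact k)"
          by (rule arg_cong)
        then show ?thesis
          using True by simp
      next
        case False
        then have "{xs\<in>L. length xs = l} = {}"
          unfolding eq by (rule if_not_P)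
        then show ?thesis
          using False by (simp only: card.empty if_False of_nat_0 mult_zero_left)
      qed
      moreover have "(\<Sum>xs\<in>{xs\<in>L. length xs = l}. g (length xs)) = real (card {xs\<in>L. length xs = l}) * g l"
        by (simp cong: sum.cong_simp)
      ultimately show "(\<Sum>xs\<in>{xs\<in>L. length xs = l}. g (length xs))
          = fact k * (if Suc l \<in> A then p_coeff A (k - l) else 0)"
        by (simp add: g_def flip: mult.assoc)
    qed simp
    also have "\<dots> = fact k * (\<Sum>i\<le>k. if Suc (k - i) \<in> A then p_coeff A i else 0)"
      unfolding sum_distrib_left[symmetric]
      by (rule arg_cong[where f = "\<lambda>x. fact k * x"],
          rule sum.reindex_bij_witness[where i = "\<lambda>i. k - i" and j = "\<lambda>i. k - i"]) auto
    also have "\<dots> = fact (Suc k) * p_coeff A (Suc k)"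
      unfolding p_coeff_recurrence(2)[OF assms(1), symmetric] by simp
    finally show ?thesis
      by (simp add: k)
  qed
qed

section \<open>Exact number of mappings with k cyclic elements\<close>

lemma binomial_fact_pow:
  assumes "n > 0"
  shows "real (n choose k) * fact k / real n ^ k = (\<Prod>i<k. 1 - real i / real n)"
proof -
  have "real (n choose k) * fact k = (\<Prod>i<k. real n - real i)"
    by (simp add: binomial_gbinomial gbinomial_prod_rev lessThan_atLeast0)
  moreover have "(\<Prod>i<k. 1 - real i / real n) = (\<Prod>i<k. real n - real i) / (\<Prod>i<k. real n)"
    unfolding prod_dividef[symmetric] using assms by (intro prod.cong) (auto simp: field_simps)
  ultimately show ?thesis
    by simp
qed

text \<open>There are C(n,k) cyclic sets, k! p(k) permutations on each and k n^(n-k-1) forests. The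
  root factor k turns p into b, and C(n,k) k! / n^k is the product. For k > n both sides vanish, as
  the product contains the factor with i = n.\<close>

lemma card_A_mappings_num_cyclic_eq:
  assumes "A \<subseteq> {1..}" "finite X" "card X = n" "n > 0"
  shows "real (card {f \<in> A_mappings X A. num_cyclic X f = k})
    = real n ^ (n - 1) * (b_coeff A k * (\<Prod>i<k. 1 - real i / real n))"
proof -
  let ?R = "{R. R \<subseteq> X \<and> card R = k}"
  have fin: "finite ?R"
    using assms(2) by simp
  have forests: "real (card (rooted_forests X R)) = real k * real n ^ (n - 1) / real n ^ k" if "R \<in> ?R" for R
  proof -
    have "X \<noteq> {}"
      using assms by auto
    moreover have "real n ^ n = real n * real n ^ (n - 1)"
      using assms(4) by (cases n) auto
    ultimately show ?thesis
      using card_rooted_forests[of X R] that assms by (simp add: field_simps)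
  qed
  have fib: "{f \<in> {f \<in> A_mappings X A. num_cyclic X f = k}. cyclic_elements X f = R}
      = {f \<in> A_mappings X A. cyclic_elements X f = R}" if "R \<in> ?R" for R
    using that by (auto simp: num_cyclic_def)
  have "card {f \<in> A_mappings X A. num_cyclic X f = k}
      = (\<Sum>R\<in>?R. card {f \<in> {f \<in> A_mappings X A. num_cyclic X f = k}. cyclic_elements X f = R})"
    by (rule card_eq_sum_fibers)
       (use assms fin in \<open>auto simp: finite_A_mappings num_cyclic_def cyclic_elements_def\<close>)
  also have "\<dots> = (\<Sum>R\<in>?R. card (A_perms R A) * card (rooted_forests X R))"
  proof (intro sum.cong)
    fix R assume R: "R \<in> ?R"
    show "card {f \<in> {f \<in> A_mappings X A. num_cyclic X f = k}. cyclic_elements X f = R}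
        = card (A_perms R A) * card (rooted_forests X R)"
      unfolding fib[OF R] using card_mappings_with_cyclic_set[OF assms(2), of R A] R by simp
  qed simp
  also have "real \<dots> = (\<Sum>R\<in>?R. fact k * p_coeff A k * (real k * real n ^ (n - 1) / real n ^ k))"
    unfolding of_nat_sum of_nat_mult
  proof (intro sum.cong)
    fix R assume R: "R \<in> ?R"
    then show "real (card (A_perms R A)) * real (card (rooted_forests X R))
        = fact k * p_coeff A k * (real k * real n ^ (n - 1) / real n ^ k)"
      using card_A_perms[OF assms(1), of R] forests[OF R] finite_subset[OF _ assms(2)] by simp
  qed simp
  also have "\<dots> = real (n choose k) * (fact k * p_coeff A k * (real k * real n ^ (n - 1) / real n ^ k))"
    using n_subsets[OF assms(2), of k] assms(3) by simp
  also have "\<dots> = real n ^ (n - 1) * (b_coeff A k * (real (n choose k) * fact k / real n ^ k))"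
    by (simp add: b_coeff_def)
  finally show ?thesis
    using binomial_fact_pow[OF assms(4)] by simp
qed

subsection \<open>The exponent\<close>

text \<open>Sums the recurrence for \<open>p_coeff\<close>: passing from n to n + 1 raises the i-th
  count by one exactly when n + 1 - i is in \<open>A\<close>. It expresses B through the counting
  function of \<open>A\<close>, to which the density applies.\<close>

lemma B_sum_convolution:
  assumes "A \<subseteq> {1..}"
  shows "B_sum A n = (\<Sum>i\<le>n. p_coeff A i * real (card {k \<in> A. k \<le> n - i}))"
proof (induction n)
  case 0
  have "{k \<in> A. k \<le> 0} = {}"
    using assms by auto
  then show ?case
    by (simp add: B_sum_def)
next
  case (Suc n)
  have c0: "{k \<in> A. k \<le> 0} = {}"
    using assms by auto
  have c: "real (card {k \<in> A. k \<le> Suc m}) = real (card {k \<in> A. k \<le> m}) + (if Suc m \<in> A then 1 else 0)" for m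
  proof (cases "Suc m \<in> A")
    case True
    then have "{k \<in> A. k \<le> Suc m} = insert (Suc m) {k \<in> A. k \<le> m}"
      by auto
    then show ?thesis
      using True by simp
  next
    case False
    then have "{k \<in> A. k \<le> Suc m} = {k \<in> A. k \<le> m}"
      using le_Suc_eq by auto
    then show ?thesis
      using False by simp
  qed
  have "B_sum A (Suc n) = B_sum A n + real (Suc n) * p_coeff A (Suc n)"
    by (simp add: B_sum_def b_coeff_def)
  also have "\<dots> = (\<Sum>i\<le>n. p_coeff A i * real (card {k \<in> A. k \<le> n - i}) + (if Suc (n - i) \<in> A then p_coeff A i else 0))"
    unfolding p_coeff_recurrence(2)[OF assms] Suc by (simp add: sum.distrib)
  also have "\<dots> = (\<Sum>i\<le>n. p_coeff A i * real (card {k \<in> A. k \<le> Suc n - i}))"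
    by (intro sum.cong) (auto simp: Suc_diff_le c algebra_simps)
  also have "\<dots> = (\<Sum>i\<le>Suc n. p_coeff A i * real (card {k \<in> A. k \<le> Suc n - i}))"
    using assms by (auto simp: c0)
  finally show ?case .
qed

text \<open>If \<kappa> > 0, the increments eventually exceed \<kappa> / (2n), while they are
  summable because \<open>v\<close> converges; the harmonic series would converge.\<close>

lemma convergent_increment_limit_le_0:
  fixes v :: "nat \<Rightarrow> real"
  assumes "convergent v" and lim: "(\<lambda>n. real n * (v (Suc n) - v n)) \<longlonglongrightarrow> \<kappa>"
  shows "\<kappa> \<le> 0"
proof (rule ccontr)
  assume "\<not> \<kappa> \<le> 0"
  then have "\<kappa> / 2 < \<kappa>" "\<kappa> > 0"
    by auto
  then have "eventually (\<lambda>n. real n * (v (Suc n) - v n) > \<kappa> / 2) sequentially"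
    using order_tendstoD(1)[OF lim] by blast
  then obtain N where N: "\<And>n. n \<ge> N \<Longrightarrow> real n * (v (Suc n) - v n) > \<kappa> / 2"
    by (auto simp: eventually_sequentially)
  have "summable (\<lambda>n. \<kappa> / 2 * inverse (of_nat n))"
  proof (rule summable_comparison_test')
    obtain l where "v \<longlonglongrightarrow> l"
      using assms(1) by (auto simp: convergent_def)
    then show "summable (\<lambda>n. v (Suc n) - v n)"
      by (rule telescope_summable)
    fix n assume n: "n \<ge> Suc N"
    then have "\<kappa> / 2 \<le> real n * (v (Suc n) - v n)"
      using N[of n] by simp
    then show "norm (\<kappa> / 2 * inverse (of_nat n)) \<le> v (Suc n) - v n"
      using n \<open>\<kappa> > 0\<close> by (simp add: field_simps)
  qed
  then have "summable (\<lambda>n. inverse (of_nat n) :: real)"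
    using \<open>\<kappa> > 0\<close> by (subst (asm) summable_cmult_iff) auto
  then show False
    using not_summable_harmonic by blast
qed

lemma convergent_increment_limit:
  fixes v :: "nat \<Rightarrow> real"
  assumes "convergent v" and "(\<lambda>n. real n * (v (Suc n) - v n)) \<longlonglongrightarrow> \<kappa>"
  shows "\<kappa> = 0"
proof -
  have "(\<lambda>n. real n * (- v (Suc n) - (- v n))) \<longlonglongrightarrow> - \<kappa>"
    using tendsto_minus[OF assms(2)] by (simp add: algebra_simps)
  then have "- \<kappa> \<le> 0"
    using assms(1) by (intro convergent_increment_limit_le_0[of "\<lambda>n. - v n"])
      (auto simp flip: convergent_minus_iff)
  then show ?thesis
    using convergent_increment_limit_le_0[OF assms] by simp
qed

text \<open>\<open>v\<close> is \<open>u\<close> divided by its scale n^(\<alpha>-1). The density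
  gives \<open>v\<close> the limit c/\<rho>, and the difference equation gives n (v(n+1) - v(n)) the
  limit c + (c/\<rho>)(1 - \<alpha>). As \<open>v\<close> converges, the latter is 0.\<close>

lemma exponent_eq:
  assumes A: "A \<subseteq> {1..}"
    and dens: "(\<lambda>n. real (card {k. k \<in> A \<and> k \<le> n}) / real n) \<longlonglongrightarrow> \<rho>" and \<rho>: "\<rho> > 0"
    and c: "c > 0" and B: "(\<lambda>n. B_sum A n / real n powr \<alpha>) \<longlonglongrightarrow> c"
  shows "\<alpha> = 1 + \<rho>"
proof -
  define a where "a m = real (card {k \<in> A. k \<le> m})" for m
  define P where "P n = (\<Sum>i\<le>n. p_coeff A i)" for n
  define u where "u n = P n - B_sum A n / real n" for n
  define v where "v n = u n / real n powr (\<alpha> - 1)" for n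
  have P: "P n \<ge> 1" for n
  proof -
    have "(\<Sum>i\<in>{0}. p_coeff A i) \<le> P n"
      unfolding P_def by (rule sum_mono2) (auto simp: p_coeff_nonneg[OF A])
    then show ?thesis
      by (simp add: p_coeff_recurrence(1)[OF A])
  qed
  have B_eq: "B_sum A n = (\<Sum>i\<le>n. p_coeff A i * real i)" for n
    unfolding B_sum_def b_coeff_def
    by (rule sum.mono_neutral_cong_left) (auto simp: mult.commute)
  have sum_diff: "(\<Sum>i\<le>n. p_coeff A i * real (n - i)) = real n * P n - B_sum A n" for n
    unfolding B_eq P_def sum_distrib_left sum_subtractf[symmetric]
    by (rule sum.cong) (auto simp: of_nat_diff algebra_simps)
  \<comment> \<open>n P - B is the convolution of \<open>p_coeff\<close> with the identity, so
    replacing the counting function \<open>a m\<close> by \<rho> m turns the convolution for B into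
    \<rho> (n P - B). The replacement error is at most \<epsilon> m + C, where \<open>C\<close>
    absorbs the finitely many small m; division by n P leaves at most \<epsilon> + C/n.\<close>
  have err: "(\<lambda>n. (B_sum A n - \<rho> * (real n * P n - B_sum A n)) / (real n * P n)) \<longlonglongrightarrow> 0"
  proof (rule LIMSEQ_I)
    fix r :: real assume r: "r > 0"
    define \<epsilon> where "\<epsilon> = r / 2"
    have \<epsilon>: "\<epsilon> > 0"
      using r by (simp add: \<epsilon>_def)
    have "(\<lambda>n. a n / real n) \<longlonglongrightarrow> \<rho>"
      using dens by (simp add: a_def)
    from LIMSEQ_D[OF this \<epsilon>] obtain N where N: "\<And>m. m \<ge> N \<Longrightarrow> \<bar>a m / real m - \<rho>\<bar> < \<epsilon>"
      by auto
    define C where "C = (\<Sum>m\<le>N. \<bar>a m - \<rho> * real m\<bar>)"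
    have C0: "C \<ge> 0"
      by (simp add: C_def sum_nonneg)
    have bound: "\<bar>a m - \<rho> * real m\<bar> \<le> \<epsilon> * real m + C" for m
    proof (cases "m \<le> N")
      case True
      then have "\<bar>a m - \<rho> * real m\<bar> \<le> C"
        unfolding C_def by (intro member_le_sum) auto
      then show ?thesis
        using \<epsilon> by (simp add: add_increasing)
    next
      case False
      then have "m > 0" "\<bar>a m / real m - \<rho>\<bar> * real m \<le> \<epsilon> * real m"
        using N[of m] by (auto intro!: mult_right_mono)
      moreover from this have "\<bar>a m / real m - \<rho>\<bar> * real m = \<bar>a m - \<rho> * real m\<bar>"
        by (simp add: abs_mult_pos left_diff_distrib)
      ultimately show ?thesis
        using C0 by simp
    qed
    have main: "\<bar>B_sum A n - \<rho> * (real n * P n - B_sum A n)\<bar> \<le> (\<epsilon> * real n + C) * P n" for n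
    proof -
      have "B_sum A n - \<rho> * (real n * P n - B_sum A n) = (\<Sum>i\<le>n. p_coeff A i * (a (n - i) - \<rho> * real (n - i)))"
      proof -
        have "(\<Sum>i\<le>n. p_coeff A i * (a (n - i) - \<rho> * real (n - i)))
            = (\<Sum>i\<le>n. p_coeff A i * a (n - i)) - \<rho> * (\<Sum>i\<le>n. p_coeff A i * real (n - i))"
          unfolding right_diff_distrib sum_subtractf sum_distrib_left by (simp add: mult.left_commute)
        then show ?thesis
          unfolding sum_diff by (simp add: B_sum_convolution[OF A] a_def)
      qed
      also have "\<bar>\<dots>\<bar> \<le> (\<Sum>i\<le>n. p_coeff A i * (\<epsilon> * real n + C))"
      proof (rule order_trans[OF sum_abs], rule sum_mono)
        fix i assume "i \<in> {..n}"
        have "\<epsilon> * real (n - i) \<le> \<epsilon> * real n"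
          using \<epsilon> by (intro mult_left_mono) auto
        then have "\<bar>a (n - i) - \<rho> * real (n - i)\<bar> \<le> \<epsilon> * real n + C"
          using bound[of "n - i"] by linarith
        then show "\<bar>p_coeff A i * (a (n - i) - \<rho> * real (n - i))\<bar> \<le> p_coeff A i * (\<epsilon> * real n + C)"
          using p_coeff_nonneg[OF A, of i] by (simp add: abs_mult mult_left_mono)
      qed
      finally show ?thesis
        by (simp add: P_def mult.commute flip: sum_distrib_right)
    qed
    obtain M where M: "real M > C / \<epsilon>"
      using reals_Archimedean2 by blast
    show "\<exists>no. \<forall>n\<ge>no. norm ((B_sum A n - \<rho> * (real n * P n - B_sum A n)) / (real n * P n) - 0) < r"
    proof (intro exI allI impI)
      fix n assume n: "n \<ge> Suc M"
      have nP: "real n * P n > 0"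
        using n P[of n] by (intro mult_pos_pos) auto
      have "C / \<epsilon> < real n"
        using M n by linarith
      then have "C < \<epsilon> * real n"
        using \<epsilon> by (simp add: field_simps)
      then have "(\<epsilon> * real n + C) * P n < (r * real n) * P n"
        using P[of n] by (intro mult_strict_right_mono) (auto simp: \<epsilon>_def)
      with main[of n] have "\<bar>B_sum A n - \<rho> * (real n * P n - B_sum A n)\<bar> < r * (real n * P n)"
        by (simp add: mult.assoc)
      then show "norm ((B_sum A n - \<rho> * (real n * P n - B_sum A n)) / (real n * P n) - 0) < r"
        using nP by (simp add: abs_divide divide_less_eq)
    qed
  qed
  have ratio: "(\<lambda>n. B_sum A n / (real n * P n)) \<longlonglongrightarrow> \<rho> / (1 + \<rho>)"
  proof -
    have "(\<lambda>n. ((B_sum A n - \<rho> * (real n * P n - B_sum A n)) / (real n * P n) + \<rho>) / (1 + \<rho>)) \<longlonglongrightarrow> (0 + \<rho>) / (1 + \<rho>)"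
      by (intro tendsto_intros err) (use \<rho> in auto)
    moreover have "eventually (\<lambda>n. ((B_sum A n - \<rho> * (real n * P n - B_sum A n)) / (real n * P n) + \<rho>) / (1 + \<rho>)
        = B_sum A n / (real n * P n)) sequentially"
      using eventually_gt_at_top[of 0]
    proof eventually_elim
      case (elim n)
      then have "real n * P n > 0"
        using P[of n] by (intro mult_pos_pos) auto
      show ?case
      proof -
        have "(b - \<rho> * (D - b)) / D + \<rho> = (1 + \<rho>) * (b / D)" if "D > 0" for b D
          using that by (simp add: field_simps)
        with \<open>real n * P n > 0\<close> show ?thesis
          using \<rho> by simp
      qed
    qed
    ultimately have "(\<lambda>n. B_sum A n / (real n * P n)) \<longlonglongrightarrow> (0 + \<rho>) / (1 + \<rho>)"
      by (rule Lim_transform_eventually)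
    then show ?thesis
      by simp
  qed
  have Bpos: "eventually (\<lambda>n. B_sum A n > 0) sequentially"
  proof -
    have "eventually (\<lambda>n. B_sum A n / real n powr \<alpha> > 0) sequentially"
      using order_tendstoD(1)[OF B c] .
    then show ?thesis
      by eventually_elim (simp add: zero_less_divide_iff)
  qed
  \<comment> \<open>With q = B / (n P), \<open>v\<close> is (1 - q)/q times B / n^\<alpha>, and q
    tends to \<rho> / (1 + \<rho>).\<close>
  have v: "v \<longlonglongrightarrow> c / \<rho>"
  proof -
    have "(\<lambda>n. (1 - B_sum A n / (real n * P n)) / (B_sum A n / (real n * P n)) * (B_sum A n / real n powr \<alpha>))
        \<longlonglongrightarrow> (1 - \<rho> / (1 + \<rho>)) / (\<rho> / (1 + \<rho>)) * c"
      by (intro tendsto_intros ratio B) (use \<rho> in auto)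
    also have "(1 - \<rho> / (1 + \<rho>)) / (\<rho> / (1 + \<rho>)) * c = c / \<rho>"
      using \<rho> by (simp add: field_simps)
    finally have "(\<lambda>n. (1 - B_sum A n / (real n * P n)) / (B_sum A n / (real n * P n)) * (B_sum A n / real n powr \<alpha>))
        \<longlonglongrightarrow> c / \<rho>" .
    moreover have "eventually (\<lambda>n. (1 - B_sum A n / (real n * P n)) / (B_sum A n / (real n * P n)) * (B_sum A n / real n powr \<alpha>)
        = v n) sequentially"
      using Bpos eventually_gt_at_top[of 0]
    proof eventually_elim
      case (elim n)
      have "real n powr \<alpha> = real n * real n powr (\<alpha> - 1)"
        using elim by (simp add: powr_diff)
      moreover have "P n > 0"
        using P[of n] by simp
      ultimately show ?case
        using elim by (simp add: v_def u_def field_simps)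
    qed
    ultimately show ?thesis
      by (rule Lim_transform_eventually)
  qed
  have "(\<lambda>n. real n * (v (Suc n) - v n)) \<longlonglongrightarrow> c * 1 + c / \<rho> * (1 - \<alpha>)"
  proof -
    have "(\<lambda>n. (real n / real (Suc n)) powr \<alpha>) \<longlonglongrightarrow> 1"
      by real_asymp
    moreover have "(\<lambda>n. real n * ((real (Suc n) / real n) powr (1 - \<alpha>) - 1)) \<longlonglongrightarrow> 1 - \<alpha>"
      by real_asymp
    \<comment> \<open>The first summand comes from the increment of \<open>u\<close>, the second
      from the change of the scale n^(\<alpha>-1).\<close>
    ultimately have "(\<lambda>n. B_sum A n / real n powr \<alpha> * (real n / real (Suc n)) powr \<alpha>
        + v n * (real n * ((real (Suc n) / real n) powr (1 - \<alpha>) - 1))) \<longlonglongrightarrow> c * 1 + c / \<rho> * (1 - \<alpha>)"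
      by (intro tendsto_intros B v)
    moreover have "eventually (\<lambda>n. B_sum A n / real n powr \<alpha> * (real n / real (Suc n)) powr \<alpha>
        + v n * (real n * ((real (Suc n) / real n) powr (1 - \<alpha>) - 1)) = real n * (v (Suc n) - v n)) sequentially"
      using eventually_gt_at_top[of 0]
    proof eventually_elim
      case (elim n)
      define N where "N = real (Suc n)"
      have pos: "real n > 0" "N > 0" and N: "N = real n + 1"
        using elim by (auto simp: N_def)
      have step: "B_sum A (Suc n) = B_sum A n + N * p_coeff A (Suc n)" "P (Suc n) = P n + p_coeff A (Suc n)"
        by (simp_all add: B_sum_def b_coeff_def P_def N_def)
      \<comment> \<open>The new coefficient p(n+1) enters P and B/(n+1) with the same weight and
        cancels; only the change of the denominator under B(n) remains.\<close>
      have du: "u (Suc n) = u n + B_sum A n / (real n * N)"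
        unfolding u_def step N_def[symmetric] using pos by (simp add: field_simps) (simp add: N algebra_simps)
      have 1: "B_sum A n / real n powr \<alpha> * (real n / N) powr \<alpha> = B_sum A n / N powr \<alpha>"
        using pos by (simp add: powr_divide)
      have 2: "N powr \<alpha> = N * N powr (\<alpha> - 1)"
        using pos by (simp add: powr_diff)
      have 3: "(N / real n) powr (1 - \<alpha>) = real n powr (\<alpha> - 1) / N powr (\<alpha> - 1)"
        using pos by (simp add: powr_divide powr_diff field_simps)
      define X where "X = N powr (\<alpha> - 1)"
      define Y where "Y = real n powr (\<alpha> - 1)"
      have XY: "X > 0" "Y > 0"
        using pos by (auto simp: X_def Y_def)
      show ?case
        unfolding N_def[symmetric] 1 3 unfolding 2 v_def du N_def[symmetric] X_def[symmetric] Y_def[symmetric]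
        using XY pos by (simp add: field_simps)
    qed
    ultimately show ?thesis
      by (rule Lim_transform_eventually)
  qed
  then have "c * 1 + c / \<rho> * (1 - \<alpha>) = 0"
    using v by (intro convergent_increment_limit[of v]) (auto simp: convergent_def)
  then have "c * (1 + \<rho>) = c * \<alpha>"
    using \<rho> by (simp add: field_simps)
  then show ?thesis
    using c by simp
qed

subsection \<open>Riemann sums\<close>

text \<open>The majorant exp (-x) is chosen because its values at the points k h form a geometric
  series. The quotient x^\<delta> exp (x - x^2/2) is below 1 from \<open>M\<close> on, and before
  \<open>M\<close> each of its factors is bounded separately.\<close>

lemma powr_gauss_le_exp:
  fixes \<delta> :: real
  assumes "\<delta> \<ge> 0"
  obtains C where "C > 0" "\<And>x. x \<ge> 0 \<Longrightarrow> x powr \<delta> * exp (- (x\<^sup>2) / 2) \<le> C * exp (- x)"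
proof -
  have "((\<lambda>x::real. x powr \<delta> * exp (x - x\<^sup>2 / 2)) \<longlongrightarrow> 0) at_top"
    by real_asymp
  then have "eventually (\<lambda>x::real. x powr \<delta> * exp (x - x\<^sup>2 / 2) < 1) at_top"
    by (rule order_tendstoD(2)) simp
  then obtain M where M: "\<And>x::real. x \<ge> M \<Longrightarrow> x powr \<delta> * exp (x - x\<^sup>2 / 2) < 1"
    by (auto simp: eventually_at_top_linorder)
  define C where "C = 1 + \<bar>M\<bar> powr \<delta> * exp \<bar>M\<bar>"
  have bound: "x powr \<delta> * exp (x - x\<^sup>2 / 2) \<le> C" if "x \<ge> 0" for x
  proof (cases "x \<ge> M")
    case True
    moreover have "C \<ge> 1"
      by (simp add: C_def)
    ultimately show ?thesis
      using M[of x] by linarith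
  next
    case False
    moreover have "x - x\<^sup>2 / 2 \<le> x"
      by simp
    ultimately have "x \<le> \<bar>M\<bar>" "x - x\<^sup>2 / 2 \<le> \<bar>M\<bar>"
      by linarith+
    then have "x powr \<delta> * exp (x - x\<^sup>2 / 2) \<le> \<bar>M\<bar> powr \<delta> * exp \<bar>M\<bar>"
      using that assms by (intro mult_mono powr_mono2) auto
    then show ?thesis
      by (simp add: C_def)
  qed
  show ?thesis
  proof (rule that)
    show "C > 0"
      by (simp add: C_def add_pos_nonneg)
    fix x :: real assume "x \<ge> 0"
    have "x powr \<delta> * exp (- (x\<^sup>2) / 2) = (x powr \<delta> * exp (x - x\<^sup>2 / 2)) * exp (- x)"
      by (simp add: mult.assoc flip: exp_add)
    also have "\<dots> \<le> C * exp (- x)"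
      using bound[OF \<open>x \<ge> 0\<close>] by (rule mult_right_mono) simp
    finally show "x powr \<delta> * exp (- (x\<^sup>2) / 2) \<le> C * exp (- x)" .
  qed
qed

text \<open>The bound alone is not inductive, so the induction carries the remainder exp (-K h) (1 +
  h), whose decrease pays for the next term because 1 + h \<le> exp h.\<close>

lemma sum_exp_le:
  fixes h :: real
  assumes "h \<ge> 0"
  shows "(\<Sum>k<K. h * exp (- (real k * h))) \<le> h + 1"
proof -
  have "(\<Sum>k<K. h * exp (- (real k * h))) \<le> h + 1 - exp (- (real K * h)) * (1 + h)"
  proof (induction K)
    case (Suc K)
    have "1 + h \<le> exp h"
      by (rule exp_ge_add_one_self)
    then have "exp (- (real (Suc K) * h)) * (1 + h) \<le> exp (- (real (Suc K) * h)) * exp h"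
      by (intro mult_left_mono) auto
    also have "\<dots> = exp (- (real K * h))"
      by (simp add: algebra_simps flip: exp_add)
    finally show ?case
      using Suc by (simp add: algebra_simps)
  qed simp
  also have "\<dots> \<le> h + 1"
    using assms by simp
  finally show ?thesis .
qed

lemma gauss_moment_deriv:
  fixes \<gamma> :: real
  assumes "x > 0"
  shows "((\<lambda>x. x powr \<gamma> * exp (- (x\<^sup>2) / 2)) has_real_derivative
    (\<gamma> * (x powr (\<gamma> - 1) * exp (- (x\<^sup>2) / 2)) - x powr (\<gamma> + 1) * exp (- (x\<^sup>2) / 2))) (at x)"
  using assms by (auto intro!: derivative_eq_intros simp: powr_add powr_diff field_simps)

lemma gauss_moment_continuous:
  fixes \<gamma> :: real
  assumes "\<gamma> > 0"
  shows "continuous_on {0..} (\<lambda>x. x powr \<gamma> * exp (- (x\<^sup>2) / 2))"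
  using assms by (intro continuous_on_mult continuous_on_powr' continuous_intros) auto

definition gauss_int :: "real \<Rightarrow> real \<Rightarrow> real" where
  "gauss_int \<rho> z = (LBINT x:{0..z}. x powr \<rho> * exp (- (x\<^sup>2) / 2))"

context
  fixes \<rho> :: real
  assumes \<rho>: "\<rho> > 0"
begin

lemma gauss_int_eq_integral: "gauss_int \<rho> z = integral {0..z} (\<lambda>x. x powr \<rho> * exp (- (x\<^sup>2) / 2))"
proof -
  have "set_integrable lborel {0..z} (\<lambda>x. x powr \<rho> * exp (- (x\<^sup>2) / 2))"
    by (rule borel_integrable_atLeastAtMost') (rule continuous_on_subset[OF gauss_moment_continuous[OF \<rho>]], auto)
  then show ?thesis
    unfolding gauss_int_def by (rule set_borel_integral_eq_integral)
qed

lemma gauss_int_continuous: "continuous_on {0..b} (gauss_int \<rho>)"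
  unfolding gauss_int_eq_integral[abs_def]
  by (intro indefinite_integral_continuous_1 integrable_continuous_real
      continuous_on_subset[OF gauss_moment_continuous[OF \<rho>]]) auto

lemma gauss_int_deriv:
  assumes "z > 0"
  shows "(gauss_int \<rho> has_real_derivative z powr \<rho> * exp (- (z\<^sup>2) / 2)) (at z)"
proof -
  have "((\<lambda>z. integral {0..z} (\<lambda>x. x powr \<rho> * exp (- (x\<^sup>2) / 2))) has_real_derivative
      z powr \<rho> * exp (- (z\<^sup>2) / 2)) (at z within {0..z + 1})"
    using assms by (intro integral_has_real_derivative continuous_on_subset[OF gauss_moment_continuous[OF \<rho>]]) auto
  moreover have "at z within {0..z + 1} = at z"
    using assms by (intro at_within_interior) auto
  ultimately show ?thesis
    by (simp add: gauss_int_eq_integral[abs_def])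
qed

lemma gauss_int_0: "gauss_int \<rho> 0 = 0"
  by (simp add: gauss_int_eq_integral)

text \<open>Integration by parts: this turns the weight \<open>\<alpha> x\<^bsup>\<alpha>-1\<^esup>\<close> of the limit law into the weight
  \<open>x\<^bsup>\<alpha>+1\<^esup>\<close> that summation by parts produces on the discrete side.\<close>

definition gauss_parts :: "real \<Rightarrow> real" where
  "gauss_parts x = (1 + \<rho>) * gauss_int \<rho> x - x powr (1 + \<rho>) * exp (- (x\<^sup>2) / 2)"

text \<open>The derivative of \<open>gauss_parts\<close> is x^(2+\<rho>) exp (-x^2/2), as the terms
  with x^\<rho> cancel; this is thus the error of the left endpoint rule on one interval. The mean
  value theorem, used twice, needs differentiability only in the open interval, which allows a =
  0.\<close>

lemma gauss_parts_step:
  obtains C where "C > 0"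
    "\<And>a h. a \<ge> 0 \<Longrightarrow> h > 0 \<Longrightarrow>
      \<bar>gauss_parts (a + h) - gauss_parts a - h * (a powr (2 + \<rho>) * exp (- (a\<^sup>2) / 2))\<bar> \<le> C * h\<^sup>2 * exp (- a)"
proof -
  let ?g = "\<lambda>x::real. x powr (2 + \<rho>) * exp (- (x\<^sup>2) / 2)"
  obtain C1 where C1: "C1 > 0" "\<And>x. x \<ge> 0 \<Longrightarrow> x powr (1 + \<rho>) * exp (- (x\<^sup>2) / 2) \<le> C1 * exp (- x)"
    using powr_gauss_le_exp[of "1 + \<rho>"] \<rho> by auto
  obtain C2 where C2: "C2 > 0" "\<And>x. x \<ge> 0 \<Longrightarrow> x powr (3 + \<rho>) * exp (- (x\<^sup>2) / 2) \<le> C2 * exp (- x)"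
    using powr_gauss_le_exp[of "3 + \<rho>"] \<rho> by auto
  \<comment> \<open>The derivative of \<open>?g\<close> has the terms (2+\<rho>) x^(1+\<rho>) and
    x^(3+\<rho>) times the Gaussian; \<open>C1\<close> and \<open>C2\<close> bound these
    moments.\<close>
  define C where "C = (2 + \<rho>) * C1 + C2"
  have C: "C > 0"
    using C1 C2 \<rho> by (auto simp: C_def intro!: add_pos_pos mult_pos_pos)
  have deriv: "(gauss_parts has_real_derivative ?g x) (at x)" if "x > 0" for x
    unfolding gauss_parts_def[abs_def]
    using DERIV_diff[OF DERIV_cmult[OF gauss_int_deriv[OF that], of "1 + \<rho>"] gauss_moment_deriv[OF that, of "1 + \<rho>"]]
    by (simp add: algebra_simps)
  have cont: "continuous_on {a..b} gauss_parts" if "a \<ge> 0" for a b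
    unfolding gauss_parts_def[abs_def] using \<rho> that
    by (intro continuous_intros continuous_on_subset[OF gauss_int_continuous[of b]]
        continuous_on_subset[OF gauss_moment_continuous]) auto
  have step: "\<bar>gauss_parts (a + h) - gauss_parts a - h * ?g a\<bar> \<le> C * h\<^sup>2 * exp (- a)" if a: "a \<ge> 0" and h: "h > 0" for a h
  proof -
    have "\<exists>l \<xi>. a < \<xi> \<and> \<xi> < a + h \<and> DERIV gauss_parts \<xi> :> l \<and> gauss_parts (a + h) - gauss_parts a = (a + h - a) * l"
    proof (rule MVT)
      fix x assume "a < x"
      then show "gauss_parts differentiable (at x)"
        using deriv[of x] a by (auto simp: real_differentiable_def)
    qed (use a h cont in auto)
    then obtain l \<xi> where \<xi>: "a < \<xi>" "\<xi> < a + h" "DERIV gauss_parts \<xi> :> l"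
      "gauss_parts (a + h) - gauss_parts a = h * l"
      by auto
    have l: "l = ?g \<xi>"
      using DERIV_unique[OF \<xi>(3)] deriv[of \<xi>] a \<xi> by auto
    have cont_g: "continuous_on {a..\<xi>} ?g"
      using a \<rho> by (intro continuous_on_subset[OF gauss_moment_continuous]) auto
    have "\<exists>l' \<eta>. a < \<eta> \<and> \<eta> < \<xi> \<and> DERIV ?g \<eta> :> l' \<and> ?g \<xi> - ?g a = (\<xi> - a) * l'"
    proof (rule MVT[OF \<xi>(1) cont_g])
      fix x assume "a < x"
      then show "?g differentiable (at x)"
        using gauss_moment_deriv[of x "2 + \<rho>"] a by (auto simp: real_differentiable_def)
    qed
    then obtain l' \<eta> where \<eta>: "a < \<eta>" "\<eta> < \<xi>" "DERIV ?g \<eta> :> l'" "?g \<xi> - ?g a = (\<xi> - a) * l'"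
      by auto
    have \<eta>0: "\<eta> > 0"
      using \<eta> a by simp
    have "l' = (2 + \<rho>) * (\<eta> powr (1 + \<rho>) * exp (- (\<eta>\<^sup>2) / 2)) - \<eta> powr (3 + \<rho>) * exp (- (\<eta>\<^sup>2) / 2)"
      using DERIV_unique[OF \<eta>(3) gauss_moment_deriv[OF \<eta>0, of "2 + \<rho>"]] by (simp add: add.commute)
    also have "\<bar>\<dots>\<bar> \<le> (2 + \<rho>) * (C1 * exp (- \<eta>)) + C2 * exp (- \<eta>)"
    proof -
      have "(2 + \<rho>) * (\<eta> powr (1 + \<rho>) * exp (- (\<eta>\<^sup>2) / 2)) \<le> (2 + \<rho>) * (C1 * exp (- \<eta>))"
        using C1(2)[of \<eta>] \<eta>0 \<rho> by (intro mult_left_mono) auto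
      moreover have "(2 + \<rho>) * (\<eta> powr (1 + \<rho>) * exp (- (\<eta>\<^sup>2) / 2)) \<ge> 0"
        using \<rho> by simp
      moreover have "\<eta> powr (3 + \<rho>) * exp (- (\<eta>\<^sup>2) / 2) \<ge> 0"
        by simp
      ultimately show ?thesis
        using C2(2)[of \<eta>] \<eta>0 by linarith
    qed
    also have "\<dots> = C * exp (- \<eta>)"
      by (simp add: C_def algebra_simps)
    also have "\<dots> \<le> C * exp (- a)"
      using C \<eta> by simp
    finally have l': "\<bar>l'\<bar> \<le> C * exp (- a)" .
    have "gauss_parts (a + h) - gauss_parts a - h * ?g a = h * (?g \<xi> - ?g a)"
      using \<xi>(4) l by (simp add: algebra_simps)
    also have "\<dots> = h * ((\<xi> - a) * l')"
      using \<eta>(4) by simp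
    finally have "\<bar>gauss_parts (a + h) - gauss_parts a - h * ?g a\<bar> = h * ((\<xi> - a) * \<bar>l'\<bar>)"
      using h \<xi> by (simp add: abs_mult)
    also have "\<dots> \<le> h * (h * (C * exp (- a)))"
      using h \<xi> l' by (intro mult_left_mono mult_mono) auto
    finally show ?thesis
      by (simp add: power2_eq_square mult_ac)
  qed
  show ?thesis
    by (rule that[OF C step])
qed

text \<open>\<open>gauss_parts\<close> vanishes at 0, so its increments telescope. The one-step
  errors C h^2 exp (-k h) add up to at most C h (h + 1) \<le> 2 C h, uniformly in
  \<open>K\<close>.\<close>

lemma gauss_parts_riemann_sum:
  obtains C where "C > 0"
    "\<And>h K. 0 < h \<Longrightarrow> h \<le> 1 \<Longrightarrow>
      \<bar>gauss_parts (real K * h) - (\<Sum>k<K. h * ((real k * h) powr (2 + \<rho>) * exp (- ((real k * h)\<^sup>2) / 2)))\<bar> \<le> C * h"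
proof -
  obtain C where C: "C > 0" "\<And>a h. a \<ge> 0 \<Longrightarrow> h > 0 \<Longrightarrow>
      \<bar>gauss_parts (a + h) - gauss_parts a - h * (a powr (2 + \<rho>) * exp (- (a\<^sup>2) / 2))\<bar> \<le> C * h\<^sup>2 * exp (- a)"
    using gauss_parts_step by blast
  show ?thesis
  proof (rule that[of "2 * C"])
    fix h :: real and K :: nat assume h: "0 < h" "h \<le> 1"
    let ?g = "\<lambda>k. (real k * h) powr (2 + \<rho>) * exp (- ((real k * h)\<^sup>2) / 2)"
    have "gauss_parts (real K * h) = (\<Sum>k<K. gauss_parts (real (Suc k) * h) - gauss_parts (real k * h))"
      by (subst sum_lessThan_telescope) (simp add: gauss_parts_def gauss_int_0)
    then have "gauss_parts (real K * h) - (\<Sum>k<K. h * ?g k)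
        = (\<Sum>k<K. gauss_parts (real k * h + h) - gauss_parts (real k * h) - h * ?g k)"
    proof -
      have "real (Suc k) * h = real k * h + h" for k
        by (simp add: algebra_simps)
      then show ?thesis
        using \<open>gauss_parts (real K * h) = _\<close> by (simp add: sum_subtractf)
    qed
    then have "\<bar>gauss_parts (real K * h) - (\<Sum>k<K. h * ?g k)\<bar>
        = \<bar>\<Sum>k<K. gauss_parts (real k * h + h) - gauss_parts (real k * h) - h * ?g k\<bar>"
      by (rule arg_cong)
    also have "\<dots> \<le> (\<Sum>k<K. C * h\<^sup>2 * exp (- (real k * h)))"
      by (rule order_trans[OF sum_abs], rule sum_mono, rule C(2)) (use h in auto)
    also have "\<dots> = C * h * (\<Sum>k<K. h * exp (- (real k * h)))"
      by (simp add: sum_distrib_left power2_eq_square mult_ac)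
    also have "\<dots> \<le> C * h * 2"
      using sum_exp_le[of h K] C(1) h by (intro mult_left_mono) auto
    finally show "\<bar>gauss_parts (real K * h) - (\<Sum>k<K. h * ?g k)\<bar> \<le> 2 * C * h"
      by simp
  qed (use C in simp)
qed

end

subsection \<open>Falling factorials\<close>

text \<open>For k \<le> n and n > 0 this is n! / ((n-k)! n^k), the chance that k independent uniform
  choices among n points are distinct.\<close>

definition ff_ratio :: "nat \<Rightarrow> nat \<Rightarrow> real" where
  "ff_ratio n k = (\<Prod>i<k. 1 - real i / real n)"

lemma ff_ratio_Suc: "ff_ratio n (Suc k) = ff_ratio n k * (1 - real k / real n)"
  by (simp add: ff_ratio_def)

lemma ff_ratio_nonneg: "k \<le> n \<Longrightarrow> ff_ratio n k \<ge> 0"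
  unfolding ff_ratio_def by (intro prod_nonneg) (auto simp: divide_le_eq)

text \<open>From 1 - x^2 \<le> (1 - x) exp x \<le> 1: the linear term in x cancels, so one step of
  the comparison with the Gaussian has an error quadratic in x and linear in h.\<close>

lemma one_minus_mult_exp_bounds:
  fixes x h :: real
  assumes "0 \<le> x" "x \<le> 1" "0 \<le> h" "h \<le> 1 / 2"
  shows "\<bar>(1 - x) * exp (x + h) - 1\<bar> \<le> 2 * x\<^sup>2 + 2 * h"
proof -
  have eh: "1 \<le> exp h" "exp h \<le> 1 + 2 * h"
  proof -
    have "exp h \<le> 1 + h + h\<^sup>2"
      using assms by (intro exp_bound) auto
    moreover have "h\<^sup>2 \<le> h"
      using assms by (simp add: power2_eq_square mult_left_le)
    ultimately show "exp h \<le> 1 + 2 * h"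
      by simp
  qed (use assms in simp)
  have "(1 - x) * exp x \<le> exp (- x) * exp x"
    using exp_ge_add_one_self[of "- x"] by (intro mult_right_mono) auto
  then have up: "(1 - x) * exp x \<le> 1"
    by (simp flip: exp_add)
  have "(1 - x) * (1 + x) \<le> (1 - x) * exp x"
    using assms by (intro mult_left_mono exp_ge_add_one_self) auto
  then have lo: "1 - x\<^sup>2 \<le> (1 - x) * exp x"
    by (simp add: power2_eq_square algebra_simps)
  have x2: "0 \<le> x\<^sup>2" "x\<^sup>2 \<le> 1"
    using assms by (auto simp: power2_eq_square mult_le_one)
  have e: "(1 - x) * exp (x + h) = (1 - x) * exp x * exp h"
    by (simp add: exp_add)
  define p where "p = (1 - x) * exp x * exp h"
  have "p \<le> 1 * exp h"
    unfolding p_def using up by (intro mult_right_mono) auto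
  moreover have "(1 - x\<^sup>2) * 1 \<le> p"
    unfolding p_def using lo eh x2 assms by (intro mult_mono) auto
  ultimately have "p - 1 \<le> 2 * h" "- (p - 1) \<le> x\<^sup>2"
    using eh by simp_all
  moreover have "2 * h \<le> 2 * x\<^sup>2 + 2 * h" "x\<^sup>2 \<le> 2 * x\<^sup>2 + 2 * h"
    using assms(3) by auto
  ultimately show ?thesis
    unfolding e p_def[symmetric] by (meson abs_leI order_trans)
qed

text \<open>The exponent k^2/(2n) grows by k/n + 1/(2n) per step, so \<open>r\<close> is multiplied
  by a factor whose distance from 1 is of order k^2/n^2 + 1/n. The bound r \<le> 2 makes these
  errors additive, and they sum to order k^3/n^2 + k/n.\<close>

lemma ff_ratio_gauss_ratio:
  assumes "n > 0" "k \<le> n"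
  defines "r \<equiv> \<lambda>k. ff_ratio n k * exp (real k ^ 2 / (2 * real n))"
  shows "r k \<le> 2" "\<bar>r k - 1\<bar> \<le> 4 * (real k ^ 3 / real n ^ 2 + real k / real n)"
proof -
  have step: "r (Suc k) = r k * ((1 - real k / real n) * exp (real k / real n + 1 / (2 * real n)))" for k
  proof -
    have "real (Suc k) ^ 2 / (2 * real n) = real k ^ 2 / (2 * real n) + (real k / real n + 1 / (2 * real n))"
      using assms by (simp add: field_simps power2_eq_square)
    then show ?thesis
      by (simp add: r_def ff_ratio_Suc exp_add)
  qed
  have r0: "r k \<ge> 0" if "k \<le> n" for k
    using ff_ratio_nonneg[OF that] by (simp add: r_def)
  have r_exp: "r k \<le> exp (real k / (2 * real n))" if "k \<le> n" for k
    using that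
  proof (induction k)
    case 0
    then show ?case
      by (simp add: r_def ff_ratio_def)
  next
    case (Suc k)
    have "(1 - real k / real n) * exp (real k / real n + 1 / (2 * real n))
        \<le> exp (- (real k / real n)) * exp (real k / real n + 1 / (2 * real n))"
      using exp_ge_add_one_self[of "- (real k / real n)"] by (intro mult_right_mono) auto
    also have "\<dots> = exp (1 / (2 * real n))"
      by (simp flip: exp_add)
    finally have "r (Suc k) \<le> exp (real k / (2 * real n)) * exp (1 / (2 * real n))"
      unfolding step using Suc r0[of k] by (intro mult_mono') (auto simp: divide_le_eq)
    also have "\<dots> = exp (real (Suc k) / (2 * real n))"
      by (simp add: add_divide_distrib flip: exp_add)
    finally show ?case .
  qed
  have r2: "r k \<le> 2" if "k \<le> n" for k
  proof -
    have "real k / (2 * real n) \<le> 1 / 2"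
      using that assms by (simp add: field_simps)
    then have "exp (real k / (2 * real n)) \<le> exp (1 / 2)"
      by simp
    also have "\<dots> \<le> 1 + 1 / 2 + (1 / 2)\<^sup>2"
      by (rule exp_bound) auto
    also have "\<dots> \<le> (2::real)"
      by (simp add: power2_eq_square)
    finally show ?thesis
      using r_exp[OF that] by simp
  qed
  show "r k \<le> 2"
    using r2 assms by simp
  have "\<bar>r k - 1\<bar> \<le> 4 * (real k ^ 3 / real n ^ 2 + real k / real n)" if "k \<le> n" for k
    using that
  proof (induction k)
    case 0
    then show ?case
      by (simp add: r_def ff_ratio_def)
  next
    case (Suc k)
    let ?y = "(1 - real k / real n) * exp (real k / real n + 1 / (2 * real n)) - 1"
    have y: "\<bar>?y\<bar> \<le> 2 * (real k / real n)\<^sup>2 + 2 * (1 / (2 * real n))"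
      using Suc.prems assms by (intro one_minus_mult_exp_bounds) (auto simp: divide_simps)
    have "r (Suc k) - 1 = (r k - 1) + r k * ?y"
      by (simp add: step algebra_simps)
    also have "\<bar>\<dots>\<bar> \<le> \<bar>r k - 1\<bar> + \<bar>r k * ?y\<bar>"
      by (rule abs_triangle_ineq)
    also have "\<bar>r k * ?y\<bar> = r k * \<bar>?y\<bar>"
      using r0[of k] Suc.prems by (simp add: abs_mult)
    also have "\<dots> \<le> 2 * (2 * (real k / real n)\<^sup>2 + 2 * (1 / (2 * real n)))"
      using y r2[of k] r0[of k] Suc.prems by (intro mult_mono) auto
    also have "\<bar>r k - 1\<bar> \<le> 4 * (real k ^ 3 / real n ^ 2 + real k / real n)"
      using Suc by simp
    \<comment> \<open>The constant 4 is 2 from r \<le> 2 times 2 from the one-step error; k^3 + k^2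
      \<le> (k+1)^3 closes the induction.\<close>
    also have "4 * (real k ^ 3 / real n ^ 2 + real k / real n) + 2 * (2 * (real k / real n)\<^sup>2 + 2 * (1 / (2 * real n)))
        = 4 * ((real k ^ 3 + real k ^ 2) / real n ^ 2 + (real k + 1 / 2) / real n)"
      by (simp add: power_divide add_divide_distrib)
    also have "\<dots> \<le> 4 * (real (Suc k) ^ 3 / real n ^ 2 + real (Suc k) / real n)"
    proof -
      have "real k ^ 3 + real k ^ 2 \<le> real (Suc k) ^ 3"
        by (simp add: power3_eq_cube power2_eq_square algebra_simps)
      then show ?thesis
        by (intro mult_left_mono add_mono divide_right_mono) auto
    qed
    finally show ?case
      by simp
  qed
  then show "\<bar>r k - 1\<bar> \<le> 4 * (real k ^ 3 / real n ^ 2 + real k / real n)"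
    using assms by simp
qed

lemma ff_ratio_gauss:
  assumes "n > 0" "k \<le> n"
  defines "x \<equiv> real k * (1 / sqrt (real n))"
  shows "ff_ratio n k \<le> 2 * exp (- (x\<^sup>2) / 2)"
    and "\<bar>ff_ratio n k - exp (- (x\<^sup>2) / 2)\<bar> \<le> 4 * (1 / sqrt (real n)) * ((x ^ 3 + x) * exp (- (x\<^sup>2) / 2))"
proof -
  let ?r = "ff_ratio n k * exp (real k ^ 2 / (2 * real n))"
  have x2: "x\<^sup>2 = real k ^ 2 / real n"
    using assms by (simp add: x_def power_divide)
  have e: "exp (- (x\<^sup>2) / 2) = 1 / exp (real k ^ 2 / (2 * real n))"
    unfolding x2 by (simp add: exp_minus field_simps)
  have ff: "ff_ratio n k = ?r * exp (- (x\<^sup>2) / 2)"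
    unfolding e by simp
  show "ff_ratio n k \<le> 2 * exp (- (x\<^sup>2) / 2)"
    using ff_ratio_gauss_ratio(1)[OF assms(1,2)] unfolding e by (simp add: field_simps)
  have s: "sqrt (real n) ^ 4 = real n ^ 2"
    using power_mult[of "sqrt (real n)" 2 2] by simp
  have x3: "(1 / sqrt (real n)) * (x ^ 3 + x) = real k ^ 3 / real n ^ 2 + real k / real n"
    using assms s by (simp add: x_def power_divide distrib_left real_sqrt_mult_self flip: power_Suc)
  have "ff_ratio n k - exp (- (x\<^sup>2) / 2) = (?r - 1) * exp (- (x\<^sup>2) / 2)"
    unfolding left_diff_distrib ff[symmetric] by simp
  then have "\<bar>ff_ratio n k - exp (- (x\<^sup>2) / 2)\<bar> = \<bar>?r - 1\<bar> * exp (- (x\<^sup>2) / 2)"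
    by (simp add: abs_mult)
  also have "\<dots> \<le> 4 * (real k ^ 3 / real n ^ 2 + real k / real n) * exp (- (x\<^sup>2) / 2)"
    using ff_ratio_gauss_ratio(2)[OF assms(1,2)] by (intro mult_right_mono) auto
  also have "\<dots> = 4 * (1 / sqrt (real n)) * ((x ^ 3 + x) * exp (- (x\<^sup>2) / 2))"
    unfolding x3[symmetric] by (simp only: mult.assoc)
  finally show "\<bar>ff_ratio n k - exp (- (x\<^sup>2) / 2)\<bar> \<le> 4 * (1 / sqrt (real n)) * ((x ^ 3 + x) * exp (- (x\<^sup>2) / 2))" .
qed

section \<open>Summation by parts and the uniform approximation\<close>

definition weighted_sum :: "nat set \<Rightarrow> nat \<Rightarrow> nat \<Rightarrow> real" where
  "weighted_sum A n K = (\<Sum>k\<le>K. b_coeff A k * ff_ratio n k)"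

text \<open>The difference \<open>ff_ratio n k - ff_ratio n (Suc k)\<close> is exactly k/n times
  \<open>ff_ratio n k\<close>.\<close>

lemma weighted_sum_by_parts:
  "weighted_sum A n K = B_sum A K * ff_ratio n K + (\<Sum>k<K. B_sum A k * (real k / real n) * ff_ratio n k)"
proof (induction K)
  case 0
  show ?case
    by (simp add: weighted_sum_def b_coeff_def B_sum_def)
next
  case (Suc K)
  have "B_sum A (Suc K) = B_sum A K + b_coeff A (Suc K)"
    by (simp add: B_sum_def)
  moreover have "weighted_sum A n (Suc K) = weighted_sum A n K + b_coeff A (Suc K) * ff_ratio n (Suc K)"
    by (simp add: weighted_sum_def)
  ultimately show ?case
    using Suc by (simp add: ff_ratio_Suc algebra_simps add_divide_distrib)
qed

lemma one_plus_powr_gauss_le_exp: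
  fixes \<delta> :: real
  assumes "\<delta> \<ge> 0"
  obtains C where "C > 0" "\<And>x. x \<ge> 0 \<Longrightarrow> (1 + x) * (x powr \<delta> * exp (- (x\<^sup>2) / 2)) \<le> C * exp (- x)"
proof -
  obtain C1 where C1: "C1 > 0" "\<And>x. x \<ge> 0 \<Longrightarrow> x powr \<delta> * exp (- (x\<^sup>2) / 2) \<le> C1 * exp (- x)"
    using powr_gauss_le_exp[OF assms] by blast
  obtain C2 where C2: "C2 > 0" "\<And>x. x \<ge> 0 \<Longrightarrow> x powr (1 + \<delta>) * exp (- (x\<^sup>2) / 2) \<le> C2 * exp (- x)"
    using powr_gauss_le_exp[of "1 + \<delta>"] assms by auto
  show ?thesis
  proof (rule that)
    show "C1 + C2 > 0"
      using C1 C2 by simp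
    fix x :: real assume x: "x \<ge> 0"
    have "(1 + x) * (x powr \<delta> * exp (- (x\<^sup>2) / 2))
        = x powr \<delta> * exp (- (x\<^sup>2) / 2) + (x * x powr \<delta>) * exp (- (x\<^sup>2) / 2)"
      by (simp only: distrib_right mult_1_left mult.assoc)
    also have "\<dots> = x powr \<delta> * exp (- (x\<^sup>2) / 2) + x powr (1 + \<delta>) * exp (- (x\<^sup>2) / 2)"
      using x by (simp only: powr_mult_base)
    also have "\<dots> \<le> (C1 + C2) * exp (- x)"
      using add_mono[OF C1(2)[OF x] C2(2)[OF x]] by (simp only: distrib_right)
    finally show "(1 + x) * (x powr \<delta> * exp (- (x\<^sup>2) / 2)) \<le> (C1 + C2) * exp (- x)" .
  qed
qed

context
  fixes \<rho> c \<beta> D :: real and A :: "nat set"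
  assumes \<rho>: "\<rho> > 0" and c: "c > 0" and \<beta>: "0 < \<beta>" "\<beta> < 1"
    and D: "\<And>k. \<bar>B_sum A k - c * real k powr (1 + \<rho>)\<bar> \<le> D * real k powr (1 + \<rho> - \<beta>)"
begin

text \<open>The discrepancy splits into the error of B times the product and the main term of B
  times the error of the product. The factor 1 + x serves two uses: the 1 covers the boundary term
  of the summation by parts, the x covers the sum, whose weight k/n is h x.\<close>

lemma B_sum_ff_ratio_approx:
  obtains M where "M > 0"
    "\<And>n k. n > 0 \<Longrightarrow> k \<le> n \<Longrightarrow>
      (1 + real k * (1 / sqrt (real n))) *
      \<bar>B_sum A k * ff_ratio n k * (1 / sqrt (real n)) powr (1 + \<rho>)
        - c * ((real k * (1 / sqrt (real n))) powr (1 + \<rho>) * exp (- ((real k * (1 / sqrt (real n)))\<^sup>2) / 2))\<bar>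
      \<le> M * ((1 / sqrt (real n)) powr \<beta> * exp (- (real k * (1 / sqrt (real n)))))"
proof -
  obtain C1 where C1: "C1 > 0"
    "\<And>x. x \<ge> 0 \<Longrightarrow> (1 + x) * (x powr (1 + \<rho> - \<beta>) * exp (- (x\<^sup>2) / 2)) \<le> C1 * exp (- x)"
    using one_plus_powr_gauss_le_exp[of "1 + \<rho> - \<beta>"] \<rho> \<beta> by auto
  obtain C2 where C2: "C2 > 0"
    "\<And>x. x \<ge> 0 \<Longrightarrow> (1 + x) * (x powr (4 + \<rho>) * exp (- (x\<^sup>2) / 2)) \<le> C2 * exp (- x)"
    using one_plus_powr_gauss_le_exp[of "4 + \<rho>"] \<rho> by auto
  obtain C3 where C3: "C3 > 0"
    "\<And>x. x \<ge> 0 \<Longrightarrow> (1 + x) * (x powr (2 + \<rho>) * exp (- (x\<^sup>2) / 2)) \<le> C3 * exp (- x)"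
    using one_plus_powr_gauss_le_exp[of "2 + \<rho>"] \<rho> by auto
  have D0: "D \<ge> 0"
    using D[of 1] by simp
  \<comment> \<open>\<open>C1\<close> belongs to the error of \<open>B_sum\<close>, of order
    x^(1+\<rho>-\<beta>); \<open>C2\<close> and \<open>C3\<close> belong to the factor x^3 + x from
    \<open>ff_ratio_gauss\<close>, which raises x^(1+\<rho>) to x^(4+\<rho>) and
    x^(2+\<rho>).\<close>
  define M where "M = 2 * D * C1 + 4 * c * (C2 + C3)"
  have M: "M > 0"
    unfolding M_def using D0 C1 C2 C3 c by (intro add_nonneg_pos mult_pos_pos) auto
  show ?thesis
  proof (rule that[OF M])
    fix n k :: nat assume n: "n > 0" and k: "k \<le> n"
    define h where "h = 1 / sqrt (real n)"
    define x where "x = real k * h"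
    define e where "e = exp (- (x\<^sup>2) / 2)"
    let ?d = "\<bar>B_sum A k * ff_ratio n k * h powr (1 + \<rho>) - c * (x powr (1 + \<rho>) * e)\<bar>"
    have h: "0 < h" "h \<le> 1"
      using n by (auto simp: h_def)
    have x: "x \<ge> 0"
      using h by (simp add: x_def)
    have e: "e > 0"
      by (simp add: e_def)
    have ff: "ff_ratio n k \<le> 2 * e" "\<bar>ff_ratio n k - e\<bar> \<le> 4 * h * ((x ^ 3 + x) * e)"
      using ff_ratio_gauss[OF n k] unfolding e_def x_def h_def by auto
    have ff0: "ff_ratio n k \<ge> 0"
      using ff_ratio_nonneg[OF k] .
    have kh: "real k powr (1 + \<rho>) * h powr (1 + \<rho>) = x powr (1 + \<rho>)"
      using h by (simp add: x_def powr_mult)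
    have "?d = \<bar>(B_sum A k - c * real k powr (1 + \<rho>)) * ff_ratio n k * h powr (1 + \<rho>)
        + c * x powr (1 + \<rho>) * (ff_ratio n k - e)\<bar>"
      unfolding kh[symmetric] by (simp add: algebra_simps)
    also have "\<dots> \<le> \<bar>(B_sum A k - c * real k powr (1 + \<rho>)) * ff_ratio n k * h powr (1 + \<rho>)\<bar>
        + \<bar>c * x powr (1 + \<rho>) * (ff_ratio n k - e)\<bar>"
      by (rule abs_triangle_ineq)
    also have "\<dots> = \<bar>B_sum A k - c * real k powr (1 + \<rho>)\<bar> * ff_ratio n k * h powr (1 + \<rho>)
        + c * x powr (1 + \<rho>) * \<bar>ff_ratio n k - e\<bar>"
      using ff0 c by (simp add: abs_mult)
    also have "\<dots> \<le> D * real k powr (1 + \<rho> - \<beta>) * (2 * e) * h powr (1 + \<rho>)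
        + c * x powr (1 + \<rho>) * (4 * h * ((x ^ 3 + x) * e))"
      using D[of k] ff ff0 c D0 by (intro add_mono mult_mono mult_right_mono mult_left_mono) auto
    also have "D * real k powr (1 + \<rho> - \<beta>) * (2 * e) * h powr (1 + \<rho>) = h powr \<beta> * (2 * D * (x powr (1 + \<rho> - \<beta>) * e))"
    proof -
      have "h powr (1 + \<rho>) = h powr (1 + \<rho> - \<beta>) * h powr \<beta>"
        by (simp flip: powr_add)
      then show ?thesis
        using h by (simp add: x_def powr_mult)
    qed
    also have "c * x powr (1 + \<rho>) * (4 * h * ((x ^ 3 + x) * e))
        = h * (4 * c * (x powr (4 + \<rho>) * e + x powr (2 + \<rho>) * e))"
    proof -
      have "x powr (4 + \<rho>) = x powr (1 + \<rho>) * x ^ 3"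
        using x powr_add[of x "1 + \<rho>" 3] by (cases "x = 0") (auto simp: powr_numeral add.commute)
      moreover have "x powr (2 + \<rho>) = x powr (1 + \<rho>) * x"
        using powr_mult_base[OF x, of "1 + \<rho>"] by (simp add: mult.commute)
      ultimately show ?thesis
        by (simp add: algebra_simps)
    qed
    \<comment> \<open>As \<beta> < 1 and h \<le> 1, the rate h powr \<beta> absorbs the error h of
      the Gaussian approximation.\<close>
    also have "h * (4 * c * (x powr (4 + \<rho>) * e + x powr (2 + \<rho>) * e))
        \<le> h powr \<beta> * (4 * c * (x powr (4 + \<rho>) * e + x powr (2 + \<rho>) * e))"
      using powr_mono'[of \<beta> 1 h] h \<beta> c e by (intro mult_right_mono) auto
    finally have "?d \<le> h powr \<beta> * (2 * D * (x powr (1 + \<rho> - \<beta>) * e) + 4 * c * (x powr (4 + \<rho>) * e + x powr (2 + \<rho>) * e))"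
      by (simp add: distrib_left)
    then have "(1 + x) * ?d \<le> (1 + x) * (h powr \<beta> * (2 * D * (x powr (1 + \<rho> - \<beta>) * e) + 4 * c * (x powr (4 + \<rho>) * e + x powr (2 + \<rho>) * e)))"
      using x by (intro mult_left_mono) auto
    also have "\<dots> = h powr \<beta> * (2 * D * ((1 + x) * (x powr (1 + \<rho> - \<beta>) * e))
        + 4 * c * ((1 + x) * (x powr (4 + \<rho>) * e) + (1 + x) * (x powr (2 + \<rho>) * e)))"
      by (simp add: algebra_simps)
    also have "\<dots> \<le> h powr \<beta> * (2 * D * (C1 * exp (- x)) + 4 * c * (C2 * exp (- x) + C3 * exp (- x)))"
      using C1(2)[OF x] C2(2)[OF x] C3(2)[OF x] D0 c unfolding e_def
      by (intro mult_left_mono add_mono) auto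
    also have "\<dots> = M * (h powr \<beta> * exp (- x))"
      by (simp add: M_def algebra_simps)
    finally show "(1 + real k * (1 / sqrt (real n))) *
      \<bar>B_sum A k * ff_ratio n k * (1 / sqrt (real n)) powr (1 + \<rho>)
        - c * ((real k * (1 / sqrt (real n))) powr (1 + \<rho>) * exp (- ((real k * (1 / sqrt (real n)))\<^sup>2) / 2))\<bar>
      \<le> M * ((1 / sqrt (real n)) powr \<beta> * exp (- (real k * (1 / sqrt (real n)))))"
      unfolding e_def x_def h_def .
  qed
qed

lemma weighted_sum_approx:
  obtains C where "C > 0"
    "\<And>n K. n > 0 \<Longrightarrow> K \<le> n \<Longrightarrow>
      \<bar>weighted_sum A n K * (1 / sqrt (real n)) powr (1 + \<rho>)
        - c * (1 + \<rho>) * gauss_int \<rho> (real K * (1 / sqrt (real n)))\<bar> \<le> C * (1 / sqrt (real n)) powr \<beta>"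
proof -
  obtain M where M: "M > 0"
    "\<And>n k. n > 0 \<Longrightarrow> k \<le> n \<Longrightarrow>
      (1 + real k * (1 / sqrt (real n))) *
      \<bar>B_sum A k * ff_ratio n k * (1 / sqrt (real n)) powr (1 + \<rho>)
        - c * ((real k * (1 / sqrt (real n))) powr (1 + \<rho>) * exp (- ((real k * (1 / sqrt (real n)))\<^sup>2) / 2))\<bar>
      \<le> M * ((1 / sqrt (real n)) powr \<beta> * exp (- (real k * (1 / sqrt (real n)))))"
    using B_sum_ff_ratio_approx by blast
  obtain C where C: "C > 0" "\<And>h K. 0 < h \<Longrightarrow> h \<le> 1 \<Longrightarrow>
      \<bar>gauss_parts \<rho> (real K * h) - (\<Sum>k<K. h * ((real k * h) powr (2 + \<rho>) * exp (- ((real k * h)\<^sup>2) / 2)))\<bar> \<le> C * h"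
    using gauss_parts_riemann_sum[OF \<rho>] by blast
  show ?thesis
  \<comment> \<open>M comes from the boundary term, 2 M from the sum and c C from the Riemann
    sum.\<close>
  proof (rule that[of "3 * M + c * C"])
    show "3 * M + c * C > 0"
      using M C c by (simp add: add_pos_pos)
    fix n K :: nat assume n: "n > 0" and K: "K \<le> n"
    define h where "h = 1 / sqrt (real n)"
    define x where "x k = real k * h" for k
    define e where "e k = exp (- ((x k)\<^sup>2) / 2)" for k
    define t where "t k = B_sum A k * ff_ratio n k * h powr (1 + \<rho>)" for k
    define s where "s k = c * (x k powr (1 + \<rho>) * e k)" for k
    have h: "0 < h" "h \<le> 1"
      using n by (auto simp: h_def)
    have x: "x k \<ge> 0" for k
      using h by (simp add: x_def)
    have bound: "(1 + x k) * \<bar>t k - s k\<bar> \<le> M * (h powr \<beta> * exp (- x k))" if "k \<le> n" for k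
      using M(2)[OF n that] unfolding t_def s_def e_def x_def h_def .
    have xk: "real k / real n = h * x k" for k
      using n by (simp add: h_def x_def)
    have W: "weighted_sum A n K * h powr (1 + \<rho>) = t K + (\<Sum>k<K. h * (x k * t k))"
      unfolding weighted_sum_by_parts xk t_def distrib_right sum_distrib_right
      by (simp add: mult_ac)
    have G: "c * (\<Sum>k<K. h * ((real k * h) powr (2 + \<rho>) * exp (- ((real k * h)\<^sup>2) / 2))) = (\<Sum>k<K. h * (x k * s k))"
    proof -
      have "x k powr (2 + \<rho>) = x k * x k powr (1 + \<rho>)" for k
        using powr_mult_base[OF x, of k "1 + \<rho>"] by simp
      then show ?thesis
        unfolding sum_distrib_left s_def e_def x_def by (simp add: mult_ac)
    qed
    have d1: "\<bar>t K - s K\<bar> \<le> M * h powr \<beta>"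
    proof -
      have "1 * \<bar>t K - s K\<bar> \<le> (1 + x K) * \<bar>t K - s K\<bar>"
        using x by (intro mult_right_mono) auto
      also have "\<dots> \<le> M * (h powr \<beta> * exp (- x K))"
        using bound[OF K] .
      also have "\<dots> \<le> M * (h powr \<beta> * 1)"
        using M(1) x[of K] by (intro mult_left_mono) auto
      finally show ?thesis
        by simp
    qed
    have d2: "\<bar>(\<Sum>k<K. h * (x k * t k)) - (\<Sum>k<K. h * (x k * s k))\<bar> \<le> M * h powr \<beta> * 2"
    proof -
      have "\<bar>(\<Sum>k<K. h * (x k * t k)) - (\<Sum>k<K. h * (x k * s k))\<bar> = \<bar>\<Sum>k<K. h * (x k * (t k - s k))\<bar>"
        by (simp add: sum_subtractf right_diff_distrib)
      also have "\<dots> \<le> (\<Sum>k<K. h * (M * (h powr \<beta> * exp (- x k))))"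
      proof (rule order_trans[OF sum_abs], rule sum_mono)
        fix k assume k: "k \<in> {..<K}"
        have "x k * \<bar>t k - s k\<bar> \<le> (1 + x k) * \<bar>t k - s k\<bar>"
          by (intro mult_right_mono) auto
        also have "\<dots> \<le> M * (h powr \<beta> * exp (- x k))"
          using bound[of k] k K by simp
        finally show "\<bar>h * (x k * (t k - s k))\<bar> \<le> h * (M * (h powr \<beta> * exp (- x k)))"
          using h x[of k] by (simp add: abs_mult)
      qed
      also have "\<dots> = M * h powr \<beta> * (\<Sum>k<K. h * exp (- (real k * h)))"
        unfolding sum_distrib_left x_def by (simp add: mult_ac)
      also have "\<dots> \<le> M * h powr \<beta> * 2"
        using sum_exp_le[of h K] h M(1) by (intro mult_left_mono) auto
      finally show ?thesis .
    qed
    have d3: "\<bar>(\<Sum>k<K. h * (x k * s k)) - c * gauss_parts \<rho> (x K)\<bar> \<le> c * C * h powr \<beta>"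
    proof -
      have "\<bar>(\<Sum>k<K. h * (x k * s k)) - c * gauss_parts \<rho> (x K)\<bar>
          = c * \<bar>gauss_parts \<rho> (x K) - (\<Sum>k<K. h * ((real k * h) powr (2 + \<rho>) * exp (- ((real k * h)\<^sup>2) / 2)))\<bar>"
        unfolding G[symmetric] right_diff_distrib[symmetric] abs_mult using c by (simp add: abs_minus_commute)
      also have "\<dots> \<le> c * (C * h)"
        unfolding x_def using C(2)[OF h, of K] c by (intro mult_left_mono) auto
      also have "\<dots> \<le> c * (C * h powr \<beta>)"
        using powr_mono'[of \<beta> 1 h] h \<beta> c C(1) by (intro mult_left_mono) auto
      finally show ?thesis
        by simp
    qed
    \<comment> \<open>The boundary term \<open>s K\<close> is c times what
      \<open>gauss_parts\<close> subtracts, so adding it back leaves the integral alone.\<close>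
    have "c * (1 + \<rho>) * gauss_int \<rho> (x K) = s K + c * gauss_parts \<rho> (x K)"
      by (simp add: gauss_parts_def[OF \<rho>] s_def e_def algebra_simps)
    then have "weighted_sum A n K * h powr (1 + \<rho>) - c * (1 + \<rho>) * gauss_int \<rho> (x K)
        = (t K - s K) + ((\<Sum>k<K. h * (x k * t k)) - (\<Sum>k<K. h * (x k * s k)))
          + ((\<Sum>k<K. h * (x k * s k)) - c * gauss_parts \<rho> (x K))"
      unfolding W by simp
    then have "\<bar>weighted_sum A n K * h powr (1 + \<rho>) - c * (1 + \<rho>) * gauss_int \<rho> (x K)\<bar>
        \<le> M * h powr \<beta> + M * h powr \<beta> * 2 + c * C * h powr \<beta>"
      using d1 d2 d3 by linarith
    then show "\<bar>weighted_sum A n K * (1 / sqrt (real n)) powr (1 + \<rho>)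
        - c * (1 + \<rho>) * gauss_int \<rho> (real K * (1 / sqrt (real n)))\<bar> \<le> (3 * M + c * C) * (1 / sqrt (real n)) powr \<beta>"
      unfolding h_def[symmetric] x_def by (simp add: algebra_simps)
  qed
qed

end

subsection \<open>The limiting integrals\<close>

lemma has_bochner_integral_exp_Ioi:
  "has_bochner_integral lborel (\<lambda>x. indicator {z<..} x *\<^sub>R exp (- x)) (exp (- z :: real))"
proof -
  have "((\<lambda>x. exp (- 1 * x)) has_integral exp (- 1 * z) / 1) {z..}"
    by (rule has_integral_exp_minus_to_infinity) simp
  then have "((\<lambda>x. exp (- x)) has_integral exp (- z)) {z..}"
    by simp
  moreover have "negligible ({z..} - {z<..})" "negligible ({z<..} - {z..})"
    by (auto intro: negligible_subset[of "{z}"])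
  ultimately have "((\<lambda>x. exp (- x)) has_integral exp (- z)) {z<..}"
    by (subst has_integral_spike_set_eq[of _ "{z..}"]) (auto intro: negligible_subset)
  then have "(\<integral>\<^sup>+x. ennreal (indicator {z<..} x * exp (- x)) \<partial>lborel) = ennreal (exp (- z))"
    by (intro nn_integral_has_integral_lebesgue) auto
  then show ?thesis
    by (intro has_bochner_integral_nn_integral) (auto simp: indicator_def)
qed

text \<open>Used at z = sqrt n to pass from the integral up to sqrt n to \<open>I_int\<close>. The
  exponential majorant also gives the integrability of the tail, on which the splitting of the
  integral rests.\<close>

lemma gauss_int_tail:
  assumes \<rho>: "\<rho> > 0"
  obtains C where "C > 0" "\<And>z. z \<ge> 0 \<Longrightarrow> 0 \<le> I_int \<rho> - gauss_int \<rho> z \<and> I_int \<rho> - gauss_int \<rho> z \<le> C * exp (- z)"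
proof -
  let ?f = "\<lambda>x::real. x powr \<rho> * exp (- (x\<^sup>2) / 2)"
  obtain C where C: "C > 0" "\<And>x. x \<ge> 0 \<Longrightarrow> ?f x \<le> C * exp (- x)"
    using powr_gauss_le_exp[of \<rho>] \<rho> by auto
  show ?thesis
  proof (rule that[OF C(1)])
    fix z :: real assume z: "z \<ge> 0"
    have int_exp: "integrable lborel (\<lambda>x. C * (indicator {z<..} x *\<^sub>R exp (- x)))"
      using has_bochner_integral_exp_Ioi[of z] by (intro integrable_mult_right) (auto simp: has_bochner_integral_iff)
    have int1: "set_integrable lborel {0..z} ?f"
      by (rule borel_integrable_atLeastAtMost') (rule continuous_on_subset[OF gauss_moment_continuous[OF \<rho>]], auto)
    have int2: "set_integrable lborel {z<..} ?f"
      unfolding set_integrable_def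
    proof (rule Bochner_Integration.integrable_bound[OF int_exp])
      show "AE x in lborel. norm (indicator {z<..} x *\<^sub>R ?f x) \<le> norm (C * (indicator {z<..} x *\<^sub>R exp (- x)))"
        using C z by (intro AE_I2) (auto simp: indicator_def abs_mult)
    qed simp
    have "{0..} = {0..z} \<union> {z<..}"
      using z by auto
    then have "I_int \<rho> = gauss_int \<rho> z + (LBINT x:{z<..}. ?f x)"
      unfolding I_int_def gauss_int_def using set_integral_Un[OF _ int1 int2] by fastforce
    moreover have "(LBINT x:{z<..}. ?f x) \<ge> 0"
      unfolding set_lebesgue_integral_def by (rule Bochner_Integration.integral_nonneg) auto
    moreover have "(LBINT x:{z<..}. ?f x) \<le> (\<integral>x. C * (indicator {z<..} x *\<^sub>R exp (- x)) \<partial>lborel)"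
      unfolding set_lebesgue_integral_def
      by (rule integral_mono[OF int2[unfolded set_integrable_def] int_exp]) (use C z in \<open>auto simp: indicator_def\<close>)
    moreover have "(\<integral>x. C * (indicator {z<..} x *\<^sub>R exp (- x)) \<partial>lborel) = C * exp (- z)"
      using has_bochner_integral_exp_Ioi[of z] by (subst integral_mult_right_zero) (simp add: has_bochner_integral_iff)
    ultimately show "0 \<le> I_int \<rho> - gauss_int \<rho> z \<and> I_int \<rho> - gauss_int \<rho> z \<le> C * exp (- z)"
      using C(1) by simp
  qed
qed

text \<open>The integrand is bounded. This pays for rounding z sqrt n down to an integer, which
  moves the endpoint by at most 1 / sqrt n.\<close>

lemma gauss_int_lipschitz:
  assumes \<rho>: "\<rho> > 0"
  obtains C where "C > 0" "\<And>y z. 0 \<le> y \<Longrightarrow> y \<le> z \<Longrightarrow> \<bar>gauss_int \<rho> z - gauss_int \<rho> y\<bar> \<le> C * (z - y)"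
proof -
  obtain C where C: "C > 0" "\<And>x. x \<ge> 0 \<Longrightarrow> x powr \<rho> * exp (- (x\<^sup>2) / 2) \<le> C * exp (- x)"
    using powr_gauss_le_exp[of \<rho>] \<rho> by auto
  show ?thesis
  proof (rule that[OF C(1)])
    fix y z :: real assume yz: "0 \<le> y" "y \<le> z"
    show "\<bar>gauss_int \<rho> z - gauss_int \<rho> y\<bar> \<le> C * (z - y)"
    proof (cases "y = z")
      case False
      then have "y < z"
        using yz by simp
      moreover have "continuous_on {y..z} (gauss_int \<rho>)"
        using yz by (intro continuous_on_subset[OF gauss_int_continuous[OF \<rho>, of z]]) auto
      moreover have "gauss_int \<rho> differentiable (at x)" if "y < x" for x
        using gauss_int_deriv[OF \<rho>, of x] yz that by (auto simp: real_differentiable_def)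
      ultimately obtain l \<xi> where \<xi>: "y < \<xi>" "\<xi> < z" "DERIV (gauss_int \<rho>) \<xi> :> l"
        "gauss_int \<rho> z - gauss_int \<rho> y = (z - y) * l"
        using MVT[of y z "gauss_int \<rho>"] by blast
      have l: "l = \<xi> powr \<rho> * exp (- (\<xi>\<^sup>2) / 2)"
        using DERIV_unique[OF \<xi>(3) gauss_int_deriv[OF \<rho>, of \<xi>]] \<xi> yz by simp
      have "\<bar>l\<bar> \<le> C * exp (- \<xi>)"
        using C(2)[of \<xi>] \<xi> yz by (simp add: l)
      also have "\<dots> \<le> C * 1"
        using C(1) \<xi> yz by (intro mult_left_mono) auto
      finally have "(z - y) * \<bar>l\<bar> \<le> (z - y) * C"
        using yz by (intro mult_left_mono) auto
      then show ?thesis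
        using \<xi>(4) yz by (simp add: abs_mult mult.commute)
    qed simp
  qed
qed

lemma I_int_pos:
  assumes \<rho>: "\<rho> > 0"
  shows "I_int \<rho> > 0"
proof -
  obtain C where "\<And>z. z \<ge> 0 \<Longrightarrow> 0 \<le> I_int \<rho> - gauss_int \<rho> z \<and> I_int \<rho> - gauss_int \<rho> z \<le> C * exp (- z)"
    using gauss_int_tail[OF \<rho>] by blast
  from this[of 1] have "gauss_int \<rho> 1 \<le> I_int \<rho>"
    by simp
  moreover have "gauss_int \<rho> 0 < gauss_int \<rho> 1"
  proof (rule DERIV_pos_imp_increasing_open[where f = "gauss_int \<rho>"])
    fix x :: real assume "0 < x"
    then show "\<exists>y. DERIV (gauss_int \<rho>) x :> y \<and> y > 0"
      using gauss_int_deriv[OF \<rho>, of x] by auto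
  qed (use gauss_int_continuous[OF \<rho>] in auto)
  ultimately show ?thesis
    by (simp add: gauss_int_0[OF \<rho>])
qed

subsection \<open>Counting by the number of cyclic elements\<close>

lemma card_A_mappings_num_cyclic_le:
  assumes "A \<subseteq> {1..}" "finite X" "card X = n" "n > 0"
  shows "real (card {f \<in> A_mappings X A. num_cyclic X f \<le> m}) = real n ^ (n - 1) * weighted_sum A n m"
proof -
  let ?F = "{f \<in> A_mappings X A. num_cyclic X f \<le> m}"
  have "card ?F = (\<Sum>k\<le>m. card {f \<in> ?F. num_cyclic X f = k})"
    by (rule card_eq_sum_fibers) (use finite_A_mappings[OF assms(2), of A] in auto)
  also have "\<dots> = (\<Sum>k\<le>m. card {f \<in> A_mappings X A. num_cyclic X f = k})"
    by (intro sum.cong arg_cong[where f = card]) auto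
  also have "real \<dots> = (\<Sum>k\<le>m. real n ^ (n - 1) * (b_coeff A k * ff_ratio n k))"
    unfolding of_nat_sum ff_ratio_def
    by (intro sum.cong refl card_A_mappings_num_cyclic_eq[OF assms])
  finally show ?thesis
    by (simp add: weighted_sum_def sum_distrib_left)
qed

lemma card_A_mappings_eq:
  assumes "A \<subseteq> {1..}" "finite X" "card X = n" "n > 0"
  shows "real (card (A_mappings X A)) = real n ^ (n - 1) * weighted_sum A n n"
proof -
  have "num_cyclic X f \<le> n" for f
    using card_mono[OF assms(2), of "cyclic_elements X f"] assms(3)
    by (auto simp: num_cyclic_def cyclic_elements_def)
  then have "{f \<in> A_mappings X A. num_cyclic X f \<le> n} = A_mappings X A"
    by auto
  then show ?thesis
    using card_A_mappings_num_cyclic_le[OF assms, of n] by simp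
qed

section \<open>Rates of convergence and the two asymptotic statements\<close>

lemma inverse_sqrt_powr: "n > 0 \<Longrightarrow> (1 / sqrt (real n)) powr \<gamma> = real n powr (- \<gamma> / 2)"
  by (simp add: powr_half_sqrt[symmetric] powr_divide powr_powr powr_minus_divide)

lemma bigo_imp_tendsto_0:
  fixes f g :: "'a \<Rightarrow> real"
  assumes "f \<in> O[F](g)" "(g \<longlongrightarrow> 0) F"
  shows "(f \<longlongrightarrow> 0) F"
proof -
  obtain C where C: "eventually (\<lambda>x. norm (f x) \<le> C * norm (g x)) F"
    using assms(1) by (elim landau_o.bigE)
  show ?thesis
    by (rule Lim_null_comparison[OF C])
       (use assms(2) in \<open>auto intro!: tendsto_mult_right_zero tendsto_rabs_zero\<close>)
qed

text \<open>After cross-multiplication the numerator is linear in the two errors. As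
  \<open>g\<close> tends to 0, \<open>b n\<close> eventually exceeds b0/2, which bounds the
  denominator below by b0^2/2.\<close>

lemma bigo_quotient:
  fixes a b :: "nat \<Rightarrow> real"
  assumes a: "(\<lambda>n. a n - a0) \<in> O(g)" and b: "(\<lambda>n. b n - b0) \<in> O(g)" and g: "g \<longlonglongrightarrow> 0" and b0: "b0 > 0"
  shows "(\<lambda>n. a n / b n - a0 / b0) \<in> O(g)"
proof -
  obtain Ca where Ca: "Ca > 0" "eventually (\<lambda>n. norm (a n - a0) \<le> Ca * norm (g n)) sequentially"
    using a by (elim landau_o.bigE)
  obtain Cb where Cb: "Cb > 0" "eventually (\<lambda>n. norm (b n - b0) \<le> Cb * norm (g n)) sequentially"
    using b by (elim landau_o.bigE)
  have "(\<lambda>n. Cb * norm (g n)) \<longlonglongrightarrow> Cb * norm (0::real)"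
    by (intro tendsto_intros g)
  then have "eventually (\<lambda>n. Cb * norm (g n) < b0 / 2) sequentially"
    using b0 by (intro order_tendstoD(2)) auto
  then have "eventually (\<lambda>n. norm (a n / b n - a0 / b0)
      \<le> ((Ca * b0 + \<bar>a0\<bar> * Cb) / (b0\<^sup>2 / 2)) * norm (g n)) sequentially"
    using Ca(2) Cb(2)
  proof eventually_elim
    case (elim n)
    then have bn: "b n > b0 / 2"
      by (auto simp: abs_le_iff)
    have "a n / b n - a0 / b0 = ((a n - a0) * b0 - a0 * (b n - b0)) / (b n * b0)"
      using bn b0 by (simp add: field_simps)
    then have "\<bar>a n / b n - a0 / b0\<bar> = \<bar>(a n - a0) * b0 - a0 * (b n - b0)\<bar> / (b n * b0)"
      using bn b0 by (simp add: abs_divide abs_mult)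
    also have "\<dots> \<le> ((Ca * b0 + \<bar>a0\<bar> * Cb) * norm (g n)) / (b0\<^sup>2 / 2)"
    proof (rule frac_le)
      have "\<bar>(a n - a0) * b0 - a0 * (b n - b0)\<bar> \<le> \<bar>a n - a0\<bar> * b0 + \<bar>a0\<bar> * \<bar>b n - b0\<bar>"
        using abs_triangle_ineq4[of "(a n - a0) * b0" "a0 * (b n - b0)"] b0 by (simp add: abs_mult)
      also have "\<dots> \<le> (Ca * norm (g n)) * b0 + \<bar>a0\<bar> * (Cb * norm (g n))"
        using elim b0 by (intro add_mono mult_right_mono mult_left_mono) auto
      finally show "\<bar>(a n - a0) * b0 - a0 * (b n - b0)\<bar> \<le> (Ca * b0 + \<bar>a0\<bar> * Cb) * norm (g n)"
        by (simp add: algebra_simps)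
      have "b0 / 2 * b0 \<le> b n * b0"
        using bn b0 by (intro mult_right_mono) auto
      then show "b0\<^sup>2 / 2 \<le> b n * b0"
        by (simp add: power2_eq_square)
    qed (use Ca Cb b0 in auto)
    finally show ?case
      by (simp only: real_norm_def times_divide_eq_left)
  qed
  then show ?thesis
    by (rule bigoI)
qed

theorem theorem1:
  fixes A :: "nat set" and \<rho> \<alpha> \<beta> c :: real and X :: "nat \<Rightarrow> 'a set"
  assumes "A \<subseteq> {1..}"
    and "(\<lambda>n. real (card {k. k \<in> A \<and> k \<le> n}) / real n) \<longlonglongrightarrow> \<rho>" and "\<rho> > 0"
    and "\<alpha> > 0" and "c > 0" and "0 < \<beta>" and "\<beta> < 1"
    and "\<exists>E \<in> O(\<lambda>k. real k powr (- \<beta>)).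
           \<forall>\<^sub>F k in sequentially. B_sum A k = c * real k powr \<alpha> * (1 + E k)"
    and "\<And>n. finite (X n)" and "\<And>n. card (X n) = n"
  shows "(\<exists>E \<in> O(\<lambda>n. real n powr (- \<beta> / 2)).
           \<forall>\<^sub>F n in sequentially.
             real (card (A_mappings (X n) A)) =
               c * (1 + \<rho>) * real n powr (real n - (1 - \<rho>) / 2) * (I_int \<rho> + E n))
       \<and> (\<forall>z>0. (\<lambda>n. measure_pmf.prob (pmf_of_set (A_mappings (X n) A))
                       {f. real (num_cyclic (X n) f) / sqrt (real n) \<le> z}
                     - (LBINT x:{0..z}. x powr \<rho> * exp (- (x\<^sup>2) / 2)) / I_int \<rho>)
                \<in> O(\<lambda>n. real n powr (- \<beta> / 2)))"
proof -
  note A = assms(1) and \<rho> = assms(3) and c = assms(5) and \<beta> = assms(6,7) and X = assms(9,10)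
  obtain E where E: "E \<in> O(\<lambda>k. real k powr (- \<beta>))"
    "\<forall>\<^sub>F k in sequentially. B_sum A k = c * real k powr \<alpha> * (1 + E k)"
    using assms(8) by blast
  obtain C0 where C0: "C0 > 0" "\<forall>\<^sub>F k in sequentially. norm (E k) \<le> C0 * norm (real k powr (- \<beta>))"
    using E(1) by (elim landau_o.bigE)
  have \<alpha>: "\<alpha> = 1 + \<rho>"
  proof (rule exponent_eq[OF A assms(2) \<rho> c])
    have "(\<lambda>k. real k powr (- \<beta>)) \<longlonglongrightarrow> 0"
      using \<beta> by real_asymp
    then have "E \<longlonglongrightarrow> 0"
      by (rule bigo_imp_tendsto_0[OF E(1)])
    then have "(\<lambda>k. c * (1 + E k)) \<longlonglongrightarrow> c * (1 + 0)"
      by (intro tendsto_intros)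
    moreover have "\<forall>\<^sub>F k in sequentially. c * (1 + E k) = B_sum A k / real k powr \<alpha>"
      using E(2) eventually_gt_at_top[of 0] by eventually_elim simp
    ultimately have "(\<lambda>n. B_sum A n / real n powr \<alpha>) \<longlonglongrightarrow> c * (1 + 0)"
      by (rule Lim_transform_eventually)
    then show "(\<lambda>n. B_sum A n / real n powr \<alpha>) \<longlonglongrightarrow> c"
      by simp
  qed
  \<comment> \<open>The hypothesis is only eventual, while summation by parts starts at k = 0. At 0
    both sides vanish; for 0 < k < N the sum \<open>S\<close> of all earlier discrepancies suffices,
    because k^(1+\<rho>-\<beta>) \<ge> 1.\<close>
  obtain D where D: "\<And>k. \<bar>B_sum A k - c * real k powr (1 + \<rho>)\<bar> \<le> D * real k powr (1 + \<rho> - \<beta>)"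
  proof -
    have "\<forall>\<^sub>F k in sequentially. \<bar>B_sum A k - c * real k powr (1 + \<rho>)\<bar> \<le> c * C0 * real k powr (1 + \<rho> - \<beta>)"
      using E(2) C0(2) eventually_gt_at_top[of 0]
    proof eventually_elim
      case (elim k)
      have "B_sum A k - c * real k powr (1 + \<rho>) = c * real k powr (1 + \<rho>) * E k"
        using elim by (simp add: \<alpha> algebra_simps)
      then have "\<bar>B_sum A k - c * real k powr (1 + \<rho>)\<bar> = c * real k powr (1 + \<rho>) * \<bar>E k\<bar>"
        using c by (simp add: abs_mult)
      also have "\<dots> \<le> c * real k powr (1 + \<rho>) * (C0 * real k powr (- \<beta>))"
        using elim c by (intro mult_left_mono) auto
      also have "\<dots> = c * C0 * (real k powr (1 + \<rho>) * real k powr (- \<beta>))"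
        by simp
      also have "real k powr (1 + \<rho>) * real k powr (- \<beta>) = real k powr (1 + \<rho> - \<beta>)"
        by (simp flip: powr_add)
      finally show ?case .
    qed
    then obtain N where N: "\<And>k. k \<ge> N \<Longrightarrow> \<bar>B_sum A k - c * real k powr (1 + \<rho>)\<bar> \<le> c * C0 * real k powr (1 + \<rho> - \<beta>)"
      by (auto simp: eventually_sequentially)
    define S where "S = (\<Sum>k<N. \<bar>B_sum A k - c * real k powr (1 + \<rho>)\<bar>)"
    have S: "S \<ge> 0"
      by (simp add: S_def sum_nonneg)
    show ?thesis
    proof (rule that[of "c * C0 + S"])
      fix k
      consider "k = 0" | "k \<ge> N" | "0 < k" "k < N"
        by linarith
      then show "\<bar>B_sum A k - c * real k powr (1 + \<rho>)\<bar> \<le> (c * C0 + S) * real k powr (1 + \<rho> - \<beta>)"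
      proof cases
        case 1
        then show ?thesis
          by (simp add: B_sum_def)
      next
        case 2
        have "c * C0 * real k powr (1 + \<rho> - \<beta>) \<le> (c * C0 + S) * real k powr (1 + \<rho> - \<beta>)"
          using S by (intro mult_right_mono) auto
        then show ?thesis
          using N[OF 2] by linarith
      next
        case 3
        have "\<bar>B_sum A k - c * real k powr (1 + \<rho>)\<bar> \<le> S"
          unfolding S_def using 3 by (intro member_le_sum) auto
        also have "\<dots> \<le> (c * C0 + S) * 1"
          using c C0 by simp
        also have "\<dots> \<le> (c * C0 + S) * real k powr (1 + \<rho> - \<beta>)"
          using c C0 S 3 \<rho> \<beta> by (intro mult_left_mono ge_one_powr_ge_zero) auto
        finally show ?thesis .
      qed
    qed
  qed
  define h where "h n = 1 / sqrt (real n)" for n :: nat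
  \<comment> \<open>\<open>r\<close> is the claimed rate; for n > 0 it equals h powr \<beta> and
    dominates h because \<beta> < 1.\<close>
  define r where "r n = real n powr (- \<beta> / 2)" for n :: nat
  have r0: "r \<longlonglongrightarrow> 0"
    unfolding r_def using \<beta> by real_asymp
  have h_r: "h n \<le> r n" and h\<beta>: "h n powr \<beta> = r n" if "n > 0" for n
  proof -
    show *: "h n powr \<beta> = r n"
      unfolding h_def r_def using that by (rule inverse_sqrt_powr)
    have "0 < h n" "h n \<le> 1"
      using that by (auto simp: h_def)
    then show "h n \<le> r n"
      using powr_mono'[of \<beta> 1 "h n"] \<beta> * by simp
  qed
  obtain C where C: "C > 0" "\<And>n K. n > 0 \<Longrightarrow> K \<le> n \<Longrightarrow>
      \<bar>weighted_sum A n K * h n powr (1 + \<rho>) - c * (1 + \<rho>) * gauss_int \<rho> (real K * h n)\<bar> \<le> C * h n powr \<beta>"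
    using weighted_sum_approx[OF \<rho> c \<beta> D] unfolding h_def by blast
  obtain Ct where Ct: "Ct > 0"
    "\<And>z. z \<ge> 0 \<Longrightarrow> 0 \<le> I_int \<rho> - gauss_int \<rho> z \<and> I_int \<rho> - gauss_int \<rho> z \<le> Ct * exp (- z)"
    using gauss_int_tail[OF \<rho>] by blast
  obtain Cl where Cl: "Cl > 0"
    "\<And>y z. 0 \<le> y \<Longrightarrow> y \<le> z \<Longrightarrow> \<bar>gauss_int \<rho> z - gauss_int \<rho> y\<bar> \<le> Cl * (z - y)"
    using gauss_int_lipschitz[OF \<rho>] by blast
  have I: "I_int \<rho> > 0"
    by (rule I_int_pos[OF \<rho>])
  define L where "L = c * (1 + \<rho>)"
  have L: "L > 0"
    using c \<rho> by (simp add: L_def)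
  define T where "T n K = weighted_sum A n K * h n powr (1 + \<rho>) / L" for n K
  have T: "\<bar>T n K - gauss_int \<rho> (real K * h n)\<bar> \<le> C / L * r n" if "n > 0" "K \<le> n" for n K
  proof -
    have "T n K - gauss_int \<rho> (real K * h n)
        = (weighted_sum A n K * h n powr (1 + \<rho>) - L * gauss_int \<rho> (real K * h n)) / L"
      using L by (simp add: T_def field_simps)
    then have "\<bar>T n K - gauss_int \<rho> (real K * h n)\<bar>
        = \<bar>weighted_sum A n K * h n powr (1 + \<rho>) - L * gauss_int \<rho> (real K * h n)\<bar> / L"
      using L by simp
    also have "\<dots> \<le> C * r n / L"
      using C(2)[OF that] L by (intro divide_right_mono) (auto simp: h\<beta>[OF that(1)] L_def)
    finally show ?thesis
      by simp
  qed
  have T_total: "(\<lambda>n. T n n - I_int \<rho>) \<in> O(r)"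
  proof (rule bigoI)
    show "eventually (\<lambda>n. norm (T n n - I_int \<rho>) \<le> (C / L + Ct) * norm (r n)) sequentially"
      using eventually_gt_at_top[of 0]
    proof eventually_elim
      case (elim n)
      have nh: "real n * h n = sqrt (real n)"
        using elim by (simp add: h_def real_div_sqrt)
      \<comment> \<open>The tail beyond sqrt n is of order exp (- sqrt n), which is below h and
        hence below r.\<close>
      have "exp (- sqrt (real n)) \<le> h n"
      proof -
        have "sqrt (real n) \<le> exp (sqrt (real n))"
          using exp_ge_add_one_self[of "sqrt (real n)"] by linarith
        then show ?thesis
          using elim by (simp add: h_def exp_minus field_simps)
      qed
      then have "Ct * exp (- sqrt (real n)) \<le> Ct * r n"
        using h_r[OF elim] Ct(1) by (intro mult_left_mono) auto
      then have "\<bar>T n n - I_int \<rho>\<bar> \<le> C / L * r n + Ct * r n"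
        using T[OF elim order_refl] Ct(2)[of "sqrt (real n)"] unfolding nh by auto
      then show ?case
        by (simp add: algebra_simps r_def)
    qed
  qed
  \<comment> \<open>The scale h^(1+\<rho>) = n^(-(1+\<rho>)/2) built into \<open>T\<close>, taken
    out of the prefactor n^(n-1), leaves the exponent n - (1-\<rho>)/2.\<close>
  have h_pow: "real n ^ (n - 1) = real n powr (real n - (1 - \<rho>) / 2) * h n powr (1 + \<rho>)" if "n > 0" for n
  proof -
    have "real n ^ (n - 1) = real n powr real (n - 1)"
      by (rule powr_realpow[symmetric]) (use that in simp)
    also have "\<dots> = real n powr (real n - (1 - \<rho>) / 2) * real n powr (- (1 + \<rho>) / 2)"
    proof -
      have "real (n - 1) = (real n - (1 - \<rho>) / 2) + (- (1 + \<rho>) / 2)"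
        using that by (simp add: of_nat_diff field_simps)
      then show ?thesis
        by (simp only: powr_add)
    qed
    also have "real n powr (- (1 + \<rho>) / 2) = h n powr (1 + \<rho>)"
      using inverse_sqrt_powr[OF that, of "1 + \<rho>"] by (simp add: h_def)
    finally show ?thesis .
  qed
  show ?thesis
  proof (intro conjI allI impI)
    show "\<exists>E \<in> O(\<lambda>n. real n powr (- \<beta> / 2)). \<forall>\<^sub>F n in sequentially. real (card (A_mappings (X n) A)) =
        c * (1 + \<rho>) * real n powr (real n - (1 - \<rho>) / 2) * (I_int \<rho> + E n)"
    proof (rule bexI[where x = "\<lambda>n. T n n - I_int \<rho>"])
      show "\<forall>\<^sub>F n in sequentially. real (card (A_mappings (X n) A)) =
          c * (1 + \<rho>) * real n powr (real n - (1 - \<rho>) / 2) * (I_int \<rho> + (T n n - I_int \<rho>))"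
        using eventually_gt_at_top[of 0]
      proof eventually_elim
        case (elim n)
        have "real (card (A_mappings (X n) A)) = real n ^ (n - 1) * weighted_sum A n n"
          by (rule card_A_mappings_eq[OF A X elim])
        also have "\<dots> = real n powr (real n - (1 - \<rho>) / 2) * (L * T n n)"
          unfolding h_pow[OF elim] T_def using L by simp
        finally show ?case
          by (simp add: L_def mult_ac)
      qed
      show "(\<lambda>n. T n n - I_int \<rho>) \<in> O(\<lambda>n. real n powr (- \<beta> / 2))"
        using T_total by (simp add: r_def[abs_def])
    qed
  next
    fix z :: real assume z: "z > 0"
    \<comment> \<open>The number of cyclic elements is an integer, so the bound z sqrt n may be
      rounded down. Eventually \<open>m n\<close> is at most n, where the approximation of
      \<open>T\<close> applies.\<close>
    define m where "m n = nat \<lfloor>z * sqrt (real n)\<rfloor>" for n :: nat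
    have "eventually (\<lambda>n::nat. z * sqrt (real n) \<le> real n) sequentially"
      by real_asymp
    then have m_le: "eventually (\<lambda>n. m n \<le> n) sequentially"
      by eventually_elim (use z in \<open>auto simp: m_def nat_le_iff floor_le_iff\<close>)
    have T_z: "(\<lambda>n. T n (m n) - gauss_int \<rho> z) \<in> O(r)"
    proof (rule bigoI)
      show "eventually (\<lambda>n. norm (T n (m n) - gauss_int \<rho> z) \<le> (C / L + Cl) * norm (r n)) sequentially"
        using eventually_gt_at_top[of 0] m_le
      proof eventually_elim
        case (elim n)
        have hpos: "h n > 0" "sqrt (real n) * h n = 1"
          using elim by (auto simp: h_def)
        have "real (m n) \<le> z * sqrt (real n)" "z * sqrt (real n) \<le> real (m n) + 1"
          using z by (auto simp: m_def)
        then have "real (m n) * h n \<le> z * sqrt (real n) * h n" "z * sqrt (real n) * h n \<le> (real (m n) + 1) * h n"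
          using hpos(1) by (auto intro: mult_right_mono)
        then have m: "real (m n) * h n \<le> z" "z - real (m n) * h n \<le> h n"
          using hpos(2) by (auto simp: mult.assoc distrib_right)
        have "\<bar>gauss_int \<rho> z - gauss_int \<rho> (real (m n) * h n)\<bar> \<le> Cl * (z - real (m n) * h n)"
          using m hpos by (intro Cl(2)) auto
        also have "\<dots> \<le> Cl * r n"
          using m(2) h_r[OF elim(1)] Cl(1) by (intro mult_left_mono) auto
        finally have "\<bar>T n (m n) - gauss_int \<rho> z\<bar> \<le> C / L * r n + Cl * r n"
          using T[OF elim] by linarith
        then show ?case
          by (simp add: algebra_simps r_def)
      qed
    qed
    have quot: "(\<lambda>n. T n (m n) / T n n - gauss_int \<rho> z / I_int \<rho>) \<in> O(r)"
      by (rule bigo_quotient[OF T_z T_total r0 I])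
    have "eventually (\<lambda>n. measure_pmf.prob (pmf_of_set (A_mappings (X n) A))
        {f. real (num_cyclic (X n) f) / sqrt (real n) \<le> z} = T n (m n) / T n n) sequentially"
    proof -
      \<comment> \<open>\<open>measure_pmf_of_set\<close> asks for a nonempty set; for large n this
        follows from the positive limit of \<open>T n n\<close>.\<close>
      have "(\<lambda>n. T n n - I_int \<rho>) \<longlonglongrightarrow> 0"
        using T_total r0 by (rule bigo_imp_tendsto_0)
      then have "eventually (\<lambda>n. T n n - I_int \<rho> > - I_int \<rho>) sequentially"
        using I by (intro order_tendstoD(1)) auto
      then show ?thesis
        using eventually_gt_at_top[of 0]
      proof eventually_elim
        case (elim n)
        let ?V = "A_mappings (X n) A"
        let ?S = "{f. real (num_cyclic (X n) f) / sqrt (real n) \<le> z}"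
        have hpos: "h n powr (1 + \<rho>) > 0"
          using elim by (simp add: h_def)
        have total: "real (card ?V) = real n ^ (n - 1) * weighted_sum A n n"
          by (rule card_A_mappings_eq[OF A X elim(2)])
        have "T n n > 0"
          using elim by simp
        then have "weighted_sum A n n > 0"
          using hpos L by (simp add: T_def zero_less_divide_iff zero_less_mult_iff)
        then have "real (card ?V) > 0"
          unfolding total using elim by simp
        then have V: "?V \<noteq> {}" "finite ?V"
          by (auto simp: card_gt_0_iff)
        have "num \<le> m n \<longleftrightarrow> real num / sqrt (real n) \<le> z" for num
        proof -
          have "num \<le> m n \<longleftrightarrow> real num \<le> z * sqrt (real n)"
            using z by (simp add: m_def le_nat_iff le_floor_iff)
          then show ?thesis
            using elim by (simp add: divide_le_eq)
        qed
        then have "?V \<inter> ?S = {f \<in> ?V. num_cyclic (X n) f \<le> m n}"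
          by auto
        then have "measure_pmf.prob (pmf_of_set ?V) ?S = real (card {f \<in> ?V. num_cyclic (X n) f \<le> m n}) / real (card ?V)"
          using measure_pmf_of_set[OF V] by simp
        also have "\<dots> = weighted_sum A n (m n) / weighted_sum A n n"
          unfolding total card_A_mappings_num_cyclic_le[OF A X elim(2)] using elim by simp
        also have "\<dots> = T n (m n) / T n n"
          using hpos L by (simp add: T_def)
        finally show ?case .
      qed
    qed
    then have ev: "eventually (\<lambda>n. measure_pmf.prob (pmf_of_set (A_mappings (X n) A))
        {f. real (num_cyclic (X n) f) / sqrt (real n) \<le> z} - gauss_int \<rho> z / I_int \<rho>
        = T n (m n) / T n n - gauss_int \<rho> z / I_int \<rho>) sequentially"
      by eventually_elim simp
    show "(\<lambda>n. measure_pmf.prob (pmf_of_set (A_mappings (X n) A))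
        {f. real (num_cyclic (X n) f) / sqrt (real n) \<le> z}
        - (LBINT x:{0..z}. x powr \<rho> * exp (- (x\<^sup>2) / 2)) / I_int \<rho>) \<in> O(\<lambda>n. real n powr (- \<beta> / 2))"
      using landau_o.big.in_cong[OF ev, of r] quot
      unfolding gauss_int_def[symmetric] r_def[abs_def] by blast
  qed
qed

end
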